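(* Let $\gamma:S^n\to\mathbb R_{>0}$ be a convex integrand. If $\gamma$ is of class $C^2$, then near any singular point of the Wulff shape $W_\gamma$, at least one of the principal curvatures of $W_\gamma$ is unbounded.
   Context: $S^n$ is the unit sphere in $\mathbb R^{n+1}$. The Wulff shape $W_\gamma$ is the boundary of $\cap_{\nu\in S^n}\{Y\in\mathbb R^{n+1}\mid\langle Y,\nu\rangle\le\gamma(\nu)\}$. $\gamma$ is a convex integrand if its homogeneous extension $\overline\gamma(rY)=r\gamma(Y)$ ($Y\in S^n$, $r\ge0$) is a convex function on $\mathbb R^{n+1}$. The Cahn-Hoffman map is $\xi_\gamma(\nu)=D\gamma|_\nu+\gamma(\nu)\nu$, where $D\gamma$ is the gradient on $S^n$. When $\gamma$ is $C^2$ and convex, $\xi_\gamma(S^n)=W_\gamma$, and $W_\gamma$ is regarded as the hypersurface parametrized by $\xi_\gamma:S^n\to\mathbb R^{n+1}$: singular points are those (images of) points of $S^n$ at which $\xi_\gamma$ is not an immersion; at regular points $\nu$ is a unit normal, the unit normal field is locally the inverse of $\xi_\gamma$, and the principal curvatures are the eigenvalues of minus its differential. *)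

theory Defs
  imports "HOL-Analysis.Analysis"
begin

section \<open>Functions on the unit sphere\<close>

text \<open>
  Throughout, the unit sphere is \<open>sphere 0 1\<close>, and a function on it is represented by a function
  on the ambient space whose values off the sphere are irrelevant: all notions below only refer to
  values at points of the sphere.
\<close>

definition continuously_differentiable_on ::
    "'a::real_normed_vector set \<Rightarrow> ('a \<Rightarrow> 'b::real_normed_vector) \<Rightarrow> bool" where
  "continuously_differentiable_on U f \<longleftrightarrow>
     (\<exists>f' :: 'a \<Rightarrow> 'a \<Rightarrow>\<^sub>L 'b.
        (\<forall>x\<in>U. (f has_derivative blinfun_apply (f' x)) (at x)) \<and> continuous_on U f')"

definition twice_continuously_differentiable_on ::
    "'a::real_normed_vector set \<Rightarrow> ('a \<Rightarrow> 'b::real_normed_vector) \<Rightarrow> bool" where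
  "twice_continuously_differentiable_on U f \<longleftrightarrow>
     (\<exists>f' :: 'a \<Rightarrow> 'a \<Rightarrow>\<^sub>L 'b.
        (\<forall>x\<in>U. (f has_derivative blinfun_apply (f' x)) (at x)) \<and>
        continuously_differentiable_on U f')"

text \<open>
  Class \<open>C\<^sup>2\<close> on the sphere as a submanifold of Euclidean space: locally the restriction of a
  \<open>C\<^sup>2\<close> function defined on an open subset of the ambient space.
\<close>

definition C2_on_sphere :: "('a::euclidean_space \<Rightarrow> real) \<Rightarrow> bool" where
  "C2_on_sphere \<gamma> \<longleftrightarrow>
     (\<forall>\<nu>\<in>sphere 0 1. \<exists>U g. open U \<and> \<nu> \<in> U \<and> twice_continuously_differentiable_on U g \<and>
        (\<forall>x\<in>U \<inter> sphere 0 1. g x = \<gamma> x))"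

definition sphere_tangent_space :: "'a::euclidean_space \<Rightarrow> 'a set" where
  "sphere_tangent_space \<nu> = {v. v \<bullet> \<nu> = 0}"

text \<open>
  A derivative within the sphere is determined on the tangent space only; the gradient is
  the representing vector that is itself tangent, which makes it unique.
\<close>

definition sphere_gradient :: "('a::euclidean_space \<Rightarrow> real) \<Rightarrow> 'a \<Rightarrow> 'a" where
  "sphere_gradient \<gamma> \<nu> =
     (THE v. v \<in> sphere_tangent_space \<nu> \<and>
             (\<gamma> has_derivative (\<lambda>h. v \<bullet> h)) (at \<nu> within sphere 0 1))"

definition sphere_immersion_at ::
    "('a::euclidean_space \<Rightarrow> 'b::real_normed_vector) \<Rightarrow> 'a \<Rightarrow> bool" where
  "sphere_immersion_at X \<nu> \<longleftrightarrow>
     (\<exists>L. (X has_derivative L) (at \<nu> within sphere 0 1) \<and> inj_on L (sphere_tangent_space \<nu>))"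


section \<open>Convex integrands and Wulff shapes\<close>

text \<open>At the origin, \<open>homogeneous_extension \<gamma>\<close> is \<open>0\<close> because of the factor \<open>norm Y\<close>.\<close>

definition homogeneous_extension :: "('a::euclidean_space \<Rightarrow> real) \<Rightarrow> 'a \<Rightarrow> real" where
  "homogeneous_extension \<gamma> Y = norm Y * \<gamma> (Y /\<^sub>R norm Y)"

definition convex_integrand :: "('a::euclidean_space \<Rightarrow> real) \<Rightarrow> bool" where
  "convex_integrand \<gamma> \<longleftrightarrow> convex_on UNIV (homogeneous_extension \<gamma>)"

definition wulff_shape :: "('a::euclidean_space \<Rightarrow> real) \<Rightarrow> 'a set" where
  "wulff_shape \<gamma> = frontier (\<Inter>\<nu>\<in>sphere 0 1. {Y. Y \<bullet> \<nu> \<le> \<gamma> \<nu>})"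

definition cahn_hoffman :: "('a::euclidean_space \<Rightarrow> real) \<Rightarrow> 'a \<Rightarrow> 'a" where
  "cahn_hoffman \<gamma> \<nu> = sphere_gradient \<gamma> \<nu> + \<gamma> \<nu> *\<^sub>R \<nu>"

text \<open>
  Singular points are points of the Wulff shape in the ambient space, whereas regular points are
  recorded by their parameter on the sphere.
\<close>

definition wulff_singular_points :: "('a::euclidean_space \<Rightarrow> real) \<Rightarrow> 'a set" where
  "wulff_singular_points \<gamma> =
     {p \<in> wulff_shape \<gamma>. \<exists>\<nu>\<in>sphere 0 1.
        p = cahn_hoffman \<gamma> \<nu> \<and> \<not> sphere_immersion_at (cahn_hoffman \<gamma>) \<nu>}"

definition wulff_regular_parameters :: "('a::euclidean_space \<Rightarrow> real) \<Rightarrow> 'a set" where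
  "wulff_regular_parameters \<gamma> = {\<nu> \<in> sphere 0 1. sphere_immersion_at (cahn_hoffman \<gamma>) \<nu>}"


section \<open>Principal curvatures\<close>

text \<open>
  \<open>A\<close> is a differential at \<open>cahn_hoffman \<gamma> \<nu>\<close> of the unit normal field \<open>N\<close>, which is the local
  inverse of the Cahn-Hoffman map and is defined on the piece of hypersurface parametrized by
  \<open>V \<inter> sphere 0 1\<close>.
\<close>

definition unit_normal_has_derivative ::
    "('a::euclidean_space \<Rightarrow> real) \<Rightarrow> 'a \<Rightarrow> ('a \<Rightarrow> 'a) \<Rightarrow> bool" where
  "unit_normal_has_derivative \<gamma> \<nu> A \<longleftrightarrow>
     (\<exists>V N. open V \<and> \<nu> \<in> V \<and>
        (\<forall>\<mu>\<in>V \<inter> sphere 0 1. N (cahn_hoffman \<gamma> \<mu>) = \<mu>) \<and>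
        (N has_derivative A)
          (at (cahn_hoffman \<gamma> \<nu>) within cahn_hoffman \<gamma> ` (V \<inter> sphere 0 1)))"

text \<open>
  At a regular point the hypersurface has tangent space \<open>sphere_tangent_space \<nu>\<close>, since \<open>\<nu>\<close> is
  normal to it. The differential of the normal field is uniquely determined there, so the choice
  made by \<open>SOME\<close> does not affect the shape operator on the tangent space.
\<close>

definition shape_operator :: "('a::euclidean_space \<Rightarrow> real) \<Rightarrow> 'a \<Rightarrow> 'a \<Rightarrow> 'a" where
  "shape_operator \<gamma> \<nu> v = - (SOME A. unit_normal_has_derivative \<gamma> \<nu> A) v"

text \<open>
  The eigenvalues of the shape operator in increasing order, repeated according to multiplicity;
  meaningful at regular points.
\<close>

definition principal_curvatures :: "('a::euclidean_space \<Rightarrow> real) \<Rightarrow> 'a \<Rightarrow> real list" where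
  "principal_curvatures \<gamma> \<nu> =
     (THE ks. sorted ks \<and>
        (\<forall>\<kappa>. count_list ks \<kappa> =
              dim {v \<in> sphere_tangent_space \<nu>. shape_operator \<gamma> \<nu> v = \<kappa> *\<^sub>R v}))"

end

theory Submission
  imports Defs "HOL-Library.Multiset"
begin

text \<open>
  The differential of the Cahn-Hoffman map at \<open>\<nu>\<close> is a symmetric operator on the tangent space of
  the sphere, and convexity makes it positive semidefinite. It depends continuously on \<open>\<nu>\<close>,
  because \<open>\<gamma>\<close> is of class \<open>C\<^sup>2\<close>, and the shape operator at a regular point is minus its inverse.
  Hence the smallest principal curvature is \<open>-1/\<rho>\<close>, where \<open>\<rho> > 0\<close> is the smallest eigenvalue of the
  differential (\<open>first_principal_curvature_bound\<close>), and a bound \<open>M\<close> for it amounts to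
  \<open>\<rho> \<ge> 1/M\<close>. It is this curvature, with index \<open>0\<close>, that is unbounded near every singular point.

  If it were bounded by \<open>M\<close> on the regular parameters over a neighbourhood of a singular point \<open>p\<close>,
  these parameters would lie in the closed set where \<open>\<rho> \<ge> 1/M\<close>, which is disjoint from the
  closed set of singular parameters. Two facts contradict this.

  First, regular points are dense in the Wulff shape (\<open>immersion_points_dense\<close>). Move from \<open>p\<close>
  slightly towards the origin, to a point \<open>q\<close> in the interior of the convex body bounded by the
  Wulff shape, and take the largest ball about \<open>q\<close> inside the body. It touches the Wulff shape close to \<open>p\<close>,
  and at a point touched from inside by a ball of radius \<open>r\<close> the differential is bounded below by a positive
  multiple of \<open>r\<close> (\<open>touching_ball_imp_immersion\<close>). By compactness \<open>p\<close> is therefore the image of a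
  parameter with \<open>\<rho> \<ge> 1/M\<close>, besides being the image of a singular parameter.

  Second, any two parameters of the same point \<open>p\<close> lie in a connected set of parameters of \<open>p\<close>
  (\<open>fibre_connected\<close>), since the fibre is the set of unit vectors of the normal cone of the body
  at \<open>p\<close>. Such a connected set would be covered by the two disjoint closed sets and meet both.
\<close>

section \<open>Directional derivatives and symmetry of second derivatives\<close>

lemma has_derivative_imp_directional:
  fixes f :: "'a::real_normed_vector \<Rightarrow> 'b::real_normed_vector"
  assumes "(f has_derivative L) (at x)"
  shows "((\<lambda>t. (f (x + t *\<^sub>R v) - f x) /\<^sub>R t) \<longlongrightarrow> L v) (at 0)"
proof -
  interpret L: bounded_linear L using assms by (rule has_derivative_bounded_linear)
  have "((\<lambda>t::real. f (x + t *\<^sub>R v)) has_derivative (\<lambda>t. L (t *\<^sub>R v))) (at 0)"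
    by (rule has_derivative_compose[where g = f and f = "\<lambda>t. x + t *\<^sub>R v"])
       (use assms in \<open>auto intro!: derivative_eq_intros\<close>)
  then have "((\<lambda>t. norm (f (x + t *\<^sub>R v) - f x - L (t *\<^sub>R v)) / norm t) \<longlongrightarrow> 0) (at 0)"
    by (auto simp: has_derivative_at)
  moreover have "norm (f (x + t *\<^sub>R v) - f x - L (t *\<^sub>R v)) / norm t
                   = norm ((f (x + t *\<^sub>R v) - f x) /\<^sub>R t - L v)" if "t \<noteq> 0" for t :: real
  proof -
    from that have "(f (x + t *\<^sub>R v) - f x) /\<^sub>R t - L v = (f (x + t *\<^sub>R v) - f x - L (t *\<^sub>R v)) /\<^sub>R t"
      by (simp add: L.scaleR algebra_simps)
    then show "norm (f (x + t *\<^sub>R v) - f x - L (t *\<^sub>R v)) / norm t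
                   = norm ((f (x + t *\<^sub>R v) - f x) /\<^sub>R t - L v)"
      by (simp add: divide_inverse mult.commute)
  qed
  ultimately have "((\<lambda>t. norm ((f (x + t *\<^sub>R v) - f x) /\<^sub>R t - L v)) \<longlongrightarrow> 0) (at 0)"
    by (subst (asm) LIM_equal) auto
  then show ?thesis
    by (simp add: tendsto_norm_zero_iff LIM_zero_iff)
qed

text \<open>
  The mean value theorem, applied in the direction \<open>u\<close> to the increment of \<open>f\<close> by \<open>t *\<^sub>R v\<close>, turns
  the second difference into an increment of the first derivative. The limit singles out the
  order of the arguments of \<open>f''\<close>, whereas the second difference is symmetric in \<open>u\<close> and \<open>v\<close>.
\<close>

lemma second_difference_tendsto:
  fixes f :: "'a::real_normed_vector \<Rightarrow> real" and f' :: "'a \<Rightarrow> 'a \<Rightarrow>\<^sub>L real"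
  assumes U: "open U" "x \<in> U"
    and f: "\<And>y. y \<in> U \<Longrightarrow> (f has_derivative f' y) (at y)"
    and f': "(f' has_derivative f'') (at x)"
  shows "((\<lambda>t. (f (x + t *\<^sub>R u + t *\<^sub>R v) - f (x + t *\<^sub>R u) - f (x + t *\<^sub>R v) + f x) / t\<^sup>2)
           \<longlongrightarrow> f'' v u) (at_right 0)"
proof (rule tendstoI)
  fix e :: real assume "e > 0"
  interpret f'': bounded_linear f'' using f' by (rule has_derivative_bounded_linear)
  \<comment> \<open>The linearisation of \<open>f'\<close> is used at two points whose distances from \<open>x\<close> add up to at most
    \<open>t * (2 * norm u + norm v)\<close>, and the result is applied to \<open>u\<close>.\<close>
  define C where "C = (2 * norm u + norm v) * norm u + 1"
  have "C > 0" by (simp add: C_def add_nonneg_pos)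
  define \<epsilon> where "\<epsilon> = e / C"
  have "\<epsilon> > 0" using \<open>e > 0\<close> \<open>C > 0\<close> by (simp add: \<epsilon>_def)
  obtain d1 where d1: "d1 > 0"
    "\<And>y. norm (y - x) < d1 \<Longrightarrow> norm (f' y - f' x - f'' (y - x)) \<le> \<epsilon> * norm (y - x)"
    using f' \<open>\<epsilon> > 0\<close> unfolding has_derivative_at_alt by blast
  obtain d2 where d2: "d2 > 0" "ball x d2 \<subseteq> U" using U open_contains_ball by blast
  define B where "B = norm u + norm v + 1"
  have "B > 0" by (simp add: B_def add_nonneg_pos)
  define d where "d = min d1 d2 / B"
  have "d > 0" using d1 d2 \<open>B > 0\<close> by (simp add: d_def)
  have main: "dist ((f (x + t *\<^sub>R u + t *\<^sub>R v) - f (x + t *\<^sub>R u) - f (x + t *\<^sub>R v) + f x) / t\<^sup>2) (f'' v u) < e"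
    if t: "0 < t" "t < d" for t
  proof -
    have tB: "t * B < min d1 d2" using t \<open>B > 0\<close> by (simp add: d_def field_simps)
    have small: "norm (s *\<^sub>R u + r *\<^sub>R v) < min d1 d2"
      if "0 \<le> s" "s \<le> t" "0 \<le> r" "r \<le> t" for s r
    proof -
      have "norm (s *\<^sub>R u + r *\<^sub>R v) \<le> s * norm u + r * norm v"
        using norm_triangle_ineq[of "s *\<^sub>R u" "r *\<^sub>R v"] that by simp
      also have "\<dots> \<le> t * norm u + t * norm v"
        using that by (intro add_mono mult_right_mono) auto
      also have "\<dots> \<le> t * B" using t by (simp add: B_def algebra_simps)
      finally show ?thesis using tB by linarith
    qed
    have inU: "x + s *\<^sub>R u + r *\<^sub>R v \<in> U"
      if "0 \<le> s" "s \<le> t" "0 \<le> r" "r \<le> t" for s r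
    proof -
      have "dist x (x + s *\<^sub>R u + r *\<^sub>R v) = norm (s *\<^sub>R u + r *\<^sub>R v)"
        by (metis add.assoc add_diff_cancel_left' dist_commute dist_norm)
      then show ?thesis using small[OF that] d2(2) by (auto simp: subset_iff)
    qed
    define \<phi> where "\<phi> s = f (x + s *\<^sub>R u + t *\<^sub>R v) - f (x + s *\<^sub>R u)" for s
    have der: "(\<phi> has_real_derivative f' (x + s *\<^sub>R u + t *\<^sub>R v) u - f' (x + s *\<^sub>R u) u) (at s)"
      if "0 \<le> s" "s \<le> t" for s
    proof -
      have 1: "(f has_derivative f' (x + s *\<^sub>R u + t *\<^sub>R v)) (at (x + s *\<^sub>R u + t *\<^sub>R v))"
        using f inU[of s t] that t by auto
      have 2: "(f has_derivative f' (x + s *\<^sub>R u)) (at (x + s *\<^sub>R u))"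
        using f inU[of s 0] that t by auto
      have 3: "((\<lambda>s. x + s *\<^sub>R u + t *\<^sub>R v) has_derivative (\<lambda>r. r *\<^sub>R u)) (at s)"
        "((\<lambda>s. x + s *\<^sub>R u) has_derivative (\<lambda>r. r *\<^sub>R u)) (at s)"
        by (auto intro!: derivative_eq_intros)
      have "(\<phi> has_derivative (\<lambda>r. f' (x + s *\<^sub>R u + t *\<^sub>R v) (r *\<^sub>R u) - f' (x + s *\<^sub>R u) (r *\<^sub>R u))) (at s)"
        unfolding \<phi>_def
        by (rule has_derivative_diff has_derivative_compose[OF 3(1) 1] has_derivative_compose[OF 3(2) 2])+
      then show ?thesis
        by (rule has_derivative_imp_has_field_derivative)
           (simp add: blinfun.scaleR_right right_diff_distrib mult.commute)
    qed
    obtain s where s: "0 < s" "s < t"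
      and eq: "\<phi> t - \<phi> 0 = (t - 0) * (f' (x + s *\<^sub>R u + t *\<^sub>R v) u - f' (x + s *\<^sub>R u) u)"
      using MVT2[of 0 t \<phi> "\<lambda>s. f' (x + s *\<^sub>R u + t *\<^sub>R v) u - f' (x + s *\<^sub>R u) u"] der t by auto
    define R1 where "R1 = f' (x + s *\<^sub>R u + t *\<^sub>R v) - f' x - f'' (s *\<^sub>R u + t *\<^sub>R v)"
    define R2 where "R2 = f' (x + s *\<^sub>R u) - f' x - f'' (s *\<^sub>R u)"
    have R1: "norm R1 \<le> \<epsilon> * norm (s *\<^sub>R u + t *\<^sub>R v)"
      using d1(2)[of "x + s *\<^sub>R u + t *\<^sub>R v"] small[of s t] s by (simp add: R1_def algebra_simps)
    have R2: "norm R2 \<le> \<epsilon> * norm (s *\<^sub>R u)"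
      using d1(2)[of "x + s *\<^sub>R u"] small[of s 0] s by (simp add: R2_def algebra_simps)
    have "norm (s *\<^sub>R u + t *\<^sub>R v) \<le> t * norm u + t * norm v"
      using norm_triangle_ineq[of "s *\<^sub>R u" "t *\<^sub>R v"] s mult_right_mono[of s t "norm u"] by simp
    moreover have "norm (s *\<^sub>R u) \<le> t * norm u" using s by (simp add: mult_right_mono)
    ultimately have "norm (R1 - R2) \<le> \<epsilon> * (t * norm u + t * norm v) + \<epsilon> * (t * norm u)"
      using R1 R2 \<open>\<epsilon> > 0\<close> norm_triangle_ineq4[of R1 R2]
        mult_left_mono[of "norm (s *\<^sub>R u + t *\<^sub>R v)" "t * norm u + t * norm v" \<epsilon>]
        mult_left_mono[of "norm (s *\<^sub>R u)" "t * norm u" \<epsilon>] by linarith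
    also have "\<dots> = \<epsilon> * t * (2 * norm u + norm v)" by (simp add: algebra_simps)
    finally have R: "norm (R1 - R2) \<le> \<epsilon> * t * (2 * norm u + norm v)" .
    have "f' (x + s *\<^sub>R u + t *\<^sub>R v) - f' (x + s *\<^sub>R u) = t *\<^sub>R f'' v + (R1 - R2)"
      by (simp add: R1_def R2_def f''.add f''.scaleR)
    then have "\<phi> t - \<phi> 0 = t * (t * f'' v u + (R1 - R2) u)"
      using eq by (simp flip: blinfun.diff_left) (simp add: blinfun.add_left blinfun.scaleR_left)
    then have "(\<phi> t - \<phi> 0) / t\<^sup>2 - f'' v u = (R1 - R2) u / t"
      using t by (simp add: power2_eq_square field_simps)
    also have "\<bar>\<dots>\<bar> \<le> norm (R1 - R2) * norm u / t"
      using norm_blinfun[of "R1 - R2" u] t by (simp add: divide_right_mono)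
    also have "\<dots> \<le> \<epsilon> * t * (2 * norm u + norm v) * norm u / t"
      using R t by (intro divide_right_mono mult_right_mono) auto
    also have "\<dots> = \<epsilon> * ((2 * norm u + norm v) * norm u)" using t by simp
    also have "\<dots> < \<epsilon> * C" using \<open>\<epsilon> > 0\<close> by (simp add: C_def)
    also have "\<dots> = e" using \<open>C > 0\<close> by (simp add: \<epsilon>_def)
    finally show ?thesis
      by (simp add: \<phi>_def dist_real_def algebra_simps)
  qed
  then show "\<forall>\<^sub>F t in at_right 0.
      dist ((f (x + t *\<^sub>R u + t *\<^sub>R v) - f (x + t *\<^sub>R u) - f (x + t *\<^sub>R v) + f x) / t\<^sup>2) (f'' v u) < e"
    using \<open>d > 0\<close> by (auto simp: eventually_at_right[of 0 1] intro!: exI[of _ d])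
qed

lemma second_derivative_symmetric:
  fixes f :: "'a::real_normed_vector \<Rightarrow> real" and f' :: "'a \<Rightarrow> 'a \<Rightarrow>\<^sub>L real"
  assumes "open U" "x \<in> U"
    and "\<And>y. y \<in> U \<Longrightarrow> (f has_derivative f' y) (at y)"
    and "(f' has_derivative f'') (at x)"
  shows "f'' u v = f'' v u"
proof (rule tendsto_unique)
  show "((\<lambda>t. (f (x + t *\<^sub>R u + t *\<^sub>R v) - f (x + t *\<^sub>R u) - f (x + t *\<^sub>R v) + f x) / t\<^sup>2)
           \<longlongrightarrow> f'' v u) (at_right 0)"
    by (rule second_difference_tendsto[OF assms])
  show "((\<lambda>t. (f (x + t *\<^sub>R u + t *\<^sub>R v) - f (x + t *\<^sub>R u) - f (x + t *\<^sub>R v) + f x) / t\<^sup>2)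
           \<longlongrightarrow> f'' u v) (at_right 0)"
    using second_difference_tendsto[OF assms, of v u] by (simp add: algebra_simps)
qed simp

section \<open>Derivatives within the sphere\<close>

lemma has_derivative_norm_sphere:
  fixes \<nu> :: "'a::euclidean_space"
  assumes "norm \<nu> = 1"
  shows "(norm has_derivative (\<lambda>h. h \<bullet> \<nu>)) (at \<nu>)"
proof -
  have "\<nu> \<noteq> 0" using assms by auto
  then show ?thesis
    using GDERIV_norm[of \<nu>] assms by (simp add: gderiv_def sgn_div_norm)
qed

lemma has_derivative_sphere_projection:
  fixes \<nu> :: "'a::euclidean_space"
  assumes "norm \<nu> = 1"
  shows "((\<lambda>x. x /\<^sub>R norm x) has_derivative (\<lambda>h. h - (h \<bullet> \<nu>) *\<^sub>R \<nu>)) (at \<nu>)"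
proof -
  have "\<nu> \<noteq> 0" using assms by auto
  then show ?thesis
    using \<open>\<nu> \<noteq> 0\<close>
    by (auto intro!: derivative_eq_intros has_derivative_norm_sphere simp: assms)
qed

text \<open>
  Composition with the radial projection replaces a derivative within the sphere by an ordinary
  one, so that its uniqueness on tangent vectors and its directional limits come from the
  corresponding facts about derivatives at interior points.
\<close>

lemma has_derivative_sphere_retract:
  fixes \<nu> :: "'a::euclidean_space"
  assumes \<nu>: "norm \<nu> = 1" and f: "(f has_derivative L) (at \<nu> within sphere 0 1)"
  shows "((\<lambda>x. f (x /\<^sub>R norm x)) has_derivative (\<lambda>h. L (h - (h \<bullet> \<nu>) *\<^sub>R \<nu>))) (at \<nu>)"
proof -
  have "\<nu> \<noteq> 0" using assms by auto
  have "((\<lambda>x. f (x /\<^sub>R norm x)) has_derivative (\<lambda>h. L (h - (h \<bullet> \<nu>) *\<^sub>R \<nu>))) (at \<nu> within (- {0}))"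
  proof (rule has_derivative_in_compose[where f = "\<lambda>x. x /\<^sub>R norm x"])
    show "((\<lambda>x. x /\<^sub>R norm x) has_derivative (\<lambda>h. h - (h \<bullet> \<nu>) *\<^sub>R \<nu>)) (at \<nu> within - {0})"
      using has_derivative_sphere_projection[OF \<nu>] by (rule has_derivative_at_withinI)
    show "(f has_derivative L) (at (\<nu> /\<^sub>R norm \<nu>) within (\<lambda>x. x /\<^sub>R norm x) ` (- {0}))"
      using has_derivative_subset[OF f, of "(\<lambda>x. x /\<^sub>R norm x) ` (- {0})"] \<nu> by (auto simp: image_subset_iff)
  qed
  moreover have "at \<nu> within (- {0}) = at \<nu>"
    using \<open>\<nu> \<noteq> 0\<close> by (intro at_within_open) auto
  ultimately show ?thesis by simp
qed

lemma has_derivative_sphere_unique: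
  fixes \<nu> :: "'a::euclidean_space"
  assumes "norm \<nu> = 1" "(f has_derivative L) (at \<nu> within sphere 0 1)"
    "(f has_derivative L') (at \<nu> within sphere 0 1)" "v \<in> sphere_tangent_space \<nu>"
  shows "L v = L' v"
proof -
  have "(\<lambda>h. L (h - (h \<bullet> \<nu>) *\<^sub>R \<nu>)) = (\<lambda>h. L' (h - (h \<bullet> \<nu>) *\<^sub>R \<nu>))"
    using has_derivative_sphere_retract[OF assms(1,2)] has_derivative_sphere_retract[OF assms(1,3)]
    by (rule has_derivative_unique)
  from fun_cong[OF this, of v] show ?thesis
    using assms(4) by (simp add: sphere_tangent_space_def)
qed

text \<open>
  Dividing the inequality by \<open>t\<^sup>2\<close> along the curve obtained by projecting \<open>\<nu> + t *\<^sub>R v\<close> to the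
  sphere passes it on to the derivative.
\<close>

lemma sphere_derivative_strongly_monotone:
  fixes \<nu> :: "'a::euclidean_space"
  assumes \<nu>: "norm \<nu> = 1" and f: "(f has_derivative L) (at \<nu> within sphere 0 1)"
    and mono: "\<And>u. u \<in> sphere 0 1 \<Longrightarrow> (f u - f \<nu>) \<bullet> (u - \<nu>) \<ge> k * ((u - \<nu>) \<bullet> (u - \<nu>))"
    and v: "v \<in> sphere_tangent_space \<nu>"
  shows "L v \<bullet> v \<ge> k * (v \<bullet> v)"
proof (rule tendsto_le)
  define c where "c t = (\<nu> + t *\<^sub>R v) /\<^sub>R norm (\<nu> + t *\<^sub>R v)" for t
  have Pv: "v - (v \<bullet> \<nu>) *\<^sub>R \<nu> = v" using v by (simp add: sphere_tangent_space_def)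
  have 1: "((\<lambda>t. (f (c t) - f \<nu>) /\<^sub>R t) \<longlongrightarrow> L v) (at 0)"
    using has_derivative_imp_directional[OF has_derivative_sphere_retract[OF \<nu> f], of v] \<nu> Pv
    by (simp add: c_def)
  have 2: "((\<lambda>t. (c t - \<nu>) /\<^sub>R t) \<longlongrightarrow> v) (at 0)"
    using has_derivative_imp_directional[OF has_derivative_sphere_projection[OF \<nu>], of v] \<nu> Pv
    by (simp add: c_def)
  show "((\<lambda>t. ((f (c t) - f \<nu>) /\<^sub>R t) \<bullet> ((c t - \<nu>) /\<^sub>R t)) \<longlongrightarrow> L v \<bullet> v) (at 0)"
    by (intro tendsto_inner 1 2)
  show "((\<lambda>t. k * (((c t - \<nu>) /\<^sub>R t) \<bullet> ((c t - \<nu>) /\<^sub>R t))) \<longlongrightarrow> k * (v \<bullet> v)) (at 0)"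
    by (intro tendsto_mult tendsto_inner tendsto_const 2)
  show "\<forall>\<^sub>F t in at 0. k * (((c t - \<nu>) /\<^sub>R t) \<bullet> ((c t - \<nu>) /\<^sub>R t))
          \<le> ((f (c t) - f \<nu>) /\<^sub>R t) \<bullet> ((c t - \<nu>) /\<^sub>R t)"
  proof (rule always_eventually, rule allI)
    fix t
    have "\<nu> + t *\<^sub>R v \<noteq> 0"
    proof
      assume "\<nu> + t *\<^sub>R v = 0"
      then have "(\<nu> + t *\<^sub>R v) \<bullet> \<nu> = 0" by simp
      then show False using \<nu> v by (simp add: inner_left_distrib sphere_tangent_space_def dot_square_norm)
    qed
    then have "c t \<in> sphere 0 1" by (simp add: c_def)
    from mono[OF this] have "inverse t * inverse t * (k * ((c t - \<nu>) \<bullet> (c t - \<nu>)))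
        \<le> inverse t * inverse t * ((f (c t) - f \<nu>) \<bullet> (c t - \<nu>))"
      by (intro mult_left_mono) auto
    then show "k * (((c t - \<nu>) /\<^sub>R t) \<bullet> ((c t - \<nu>) /\<^sub>R t))
          \<le> ((f (c t) - f \<nu>) /\<^sub>R t) \<bullet> ((c t - \<nu>) /\<^sub>R t)"
      by (simp add: algebra_simps)
  qed
qed simp


lemma has_derivative_sphere_tangential:
  fixes \<nu> :: "'a::euclidean_space"
  assumes "norm \<nu> = 1" "(f has_derivative L) (at \<nu> within sphere 0 1)"
  shows "(f has_derivative (\<lambda>h. L (h - (h \<bullet> \<nu>) *\<^sub>R \<nu>))) (at \<nu> within sphere 0 1)"
  using has_derivative_at_withinI[OF has_derivative_sphere_retract[OF assms]]
  by (rule has_derivative_transform[rotated 2]) (use assms in auto)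

section \<open>Symmetric operators on a subspace\<close>

lemma nonneg_quadratic_imp_linear_coeff_zero:
  fixes b c :: real
  assumes nonneg: "\<And>t. 2 * t * b + t\<^sup>2 * c \<ge> 0"
  shows "b = 0"
proof (rule ccontr)
  assume nz: "b \<noteq> 0"
  have "c \<ge> 0" using nonneg[of 1] nonneg[of "-1"] by simp
  \<comment> \<open>The minimiser for the leading coefficient \<open>c + 1\<close>, which is positive even if \<open>c = 0\<close>.\<close>
  define t where "t = - b / (c + 1)"
  have "0 \<le> 2 * t * b + t\<^sup>2 * c" by (rule nonneg)
  also have "\<dots> \<le> 2 * t * b + t * (t * (c + 1))"
    by (simp add: power2_eq_square mult_left_mono algebra_simps)
  also have "t * (c + 1) = - b" using \<open>c \<ge> 0\<close> by (simp add: t_def)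
  also have "2 * t * b + t * - b = - (b\<^sup>2 / (c + 1))"
    by (simp add: t_def power2_eq_square)
  also have "\<dots> < 0" using nz \<open>c \<ge> 0\<close> by simp
  finally show False by simp
qed

locale symmetric_on_subspace =
  fixes V :: "'a::euclidean_space set" and L :: "'a \<Rightarrow> 'a"
  assumes subspace: "subspace V" and linear: "linear L"
    and invariant: "v \<in> V \<Longrightarrow> L v \<in> V"
    and symmetric: "v \<in> V \<Longrightarrow> w \<in> V \<Longrightarrow> L v \<bullet> w = L w \<bullet> v"
begin

text \<open>
  The quadratic form of \<open>L - \<rho>\<close> is nonnegative and vanishes at \<open>v\<close>, so its first variation at \<open>v\<close>
  vanishes.
\<close>

lemma psd_kernel:
  assumes psd: "\<And>w. w \<in> V \<Longrightarrow> L w \<bullet> w \<ge> \<rho> * (w \<bullet> w)" and v: "v \<in> V" "L v \<bullet> v = \<rho> * (v \<bullet> v)"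
  shows "L v = \<rho> *\<^sub>R v"
proof -
  define B where "B x y = L x \<bullet> y - \<rho> * (x \<bullet> y)" for x y
  define w where "w = L v - \<rho> *\<^sub>R v"
  have w: "w \<in> V"
    unfolding w_def by (intro subspace_diff subspace_scale subspace invariant v)
  have "B v v = 0" using v by (simp add: B_def)
  moreover have "B (v + t *\<^sub>R w) (v + t *\<^sub>R w) = B v v + 2 * t * B v w + t\<^sup>2 * B w w" for t
    using symmetric[OF v(1) w]
    by (simp add: B_def linear_add[OF linear] linear_scale[OF linear] algebra_simps
        inner_commute[of w v] power2_eq_square)
  moreover have "B (v + t *\<^sub>R w) (v + t *\<^sub>R w) \<ge> 0" for t
    using psd[of "v + t *\<^sub>R w"] v w subspace by (simp add: B_def subspace_add subspace_scale)
  ultimately have "B v w = 0"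
    by (intro nonneg_quadratic_imp_linear_coeff_zero[of "B v w" "B w w"]) (metis add_0)
  then have "w \<bullet> w = 0" by (simp add: B_def w_def inner_diff_left)
  then show ?thesis by (simp add: w_def)
qed

lemma smallest_eigenvalue:
  assumes "\<not> V \<subseteq> {0}"
  obtains \<rho> v where "v \<in> V" "v \<noteq> 0" "L v = \<rho> *\<^sub>R v" "\<And>w. w \<in> V \<Longrightarrow> L w \<bullet> w \<ge> \<rho> * (w \<bullet> w)"
proof -
  define K where "K = V \<inter> sphere 0 1"
  obtain u where u: "u \<in> V" "u \<noteq> 0" using assms by auto
  have "compact K"
    unfolding K_def by (intro closed_Int_compact closed_subspace subspace compact_sphere)
  moreover have "u /\<^sub>R norm u \<in> K"
    using u subspace by (auto simp: K_def subspace_scale)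
  moreover have "continuous_on K (\<lambda>v. L v \<bullet> v)"
    by (intro continuous_intros linear_continuous_on) (use linear in \<open>simp add: linear_conv_bounded_linear\<close>)
  ultimately obtain v where v: "v \<in> K" and min: "\<And>w. w \<in> K \<Longrightarrow> L v \<bullet> v \<le> L w \<bullet> w"
    using continuous_attains_inf[of K "\<lambda>v. L v \<bullet> v"] by blast
  define \<rho> where "\<rho> = L v \<bullet> v"
  have psd: "L w \<bullet> w \<ge> \<rho> * (w \<bullet> w)" if "w \<in> V" for w
  proof (cases "w = 0")
    case False
    define c where "c = inverse (norm w)"
    have "c *\<^sub>R w \<in> K" using that False subspace by (auto simp: K_def c_def subspace_scale)
    from min[OF this] have "\<rho> \<le> c\<^sup>2 * (L w \<bullet> w)"
      by (simp add: \<rho>_def linear_scale[OF linear] power2_eq_square)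
    then have "\<rho> * (norm w)\<^sup>2 \<le> c\<^sup>2 * (L w \<bullet> w) * (norm w)\<^sup>2"
      by (rule mult_right_mono) simp
    also have "\<dots> = (c * norm w)\<^sup>2 * (L w \<bullet> w)" by (simp add: power_mult_distrib)
    also have "c * norm w = 1" using False by (simp add: c_def)
    finally show ?thesis by (simp add: dot_square_norm)
  qed (simp add: linear_0[OF linear])
  have vv: "v \<bullet> v = 1" "v \<in> V" "v \<noteq> 0" using v by (auto simp: K_def dot_square_norm)
  have "L v = \<rho> *\<^sub>R v" using psd_kernel[OF psd vv(2)] vv(1) by (simp add: \<rho>_def)
  then show thesis using that vv psd by blast
qed

lemma finite_eigenvalues: "finite {\<rho>. \<exists>v\<in>V. v \<noteq> 0 \<and> L v = \<rho> *\<^sub>R v}" (is "finite ?E")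
proof -
  obtain e where e: "\<And>\<rho>. \<rho> \<in> ?E \<Longrightarrow> e \<rho> \<in> V \<and> e \<rho> \<noteq> 0 \<and> L (e \<rho>) = \<rho> *\<^sub>R e \<rho>"
    using bchoice[of ?E "\<lambda>\<rho> v. v \<in> V \<and> v \<noteq> 0 \<and> L v = \<rho> *\<^sub>R v"] by blast
  have orth: "e \<rho> \<bullet> e \<mu> = 0" if "\<rho> \<in> ?E" "\<mu> \<in> ?E" "\<rho> \<noteq> \<mu>" for \<rho> \<mu>
  proof -
    have "\<rho> * (e \<rho> \<bullet> e \<mu>) = \<mu> * (e \<rho> \<bullet> e \<mu>)"
      using symmetric[of "e \<rho>" "e \<mu>"] e[OF that(1)] e[OF that(2)] by (simp add: inner_commute)
    then show ?thesis using that(3) by simp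
  qed
  have "independent (e ` ?E)"
  proof (rule pairwise_orthogonal_independent)
    show "pairwise orthogonal (e ` ?E)" using orth by (auto simp: pairwise_def orthogonal_def)
    show "0 \<notin> e ` ?E" using e by force
  qed
  then have "finite (e ` ?E)" by (rule finiteI_independent)
  moreover have "inj_on e ?E"
  proof (rule inj_onI, rule ccontr)
    fix \<rho> \<mu> assume "\<rho> \<in> ?E" "\<mu> \<in> ?E" "e \<rho> = e \<mu>" "\<rho> \<noteq> \<mu>"
    then show False using orth[of \<rho> \<mu>] e[of \<mu>] by auto
  qed
  ultimately show ?thesis by (rule finite_imageD)
qed

end

text \<open>
  This makes the description by \<open>THE\<close> of the list of principal curvatures meaningful as soon as
  only finitely many eigenspaces are nonzero.
\<close>

lemma ex1_sorted_list_with_counts: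
  fixes d :: "'a::linorder \<Rightarrow> nat"
  assumes "finite {x. d x \<noteq> 0}"
  shows "\<exists>!xs. sorted xs \<and> (\<forall>x. count_list xs x = d x)"
proof (rule ex1I)
  let ?M = "Abs_multiset d"
  have "count ?M = d" using assms by (intro count_Abs_multiset) simp
  then show "sorted (sorted_list_of_multiset ?M) \<and> (\<forall>x. count_list (sorted_list_of_multiset ?M) x = d x)"
    by (simp flip: count_mset)
  fix xs assume xs: "sorted xs \<and> (\<forall>x. count_list xs x = d x)"
  then have "mset xs = ?M" using \<open>count ?M = d\<close> by (intro multiset_eqI) (simp add: count_mset)
  then show "xs = sorted_list_of_multiset ?M"
    using xs by (metis sorted_list_of_multiset_mset sorted_sort_id)
qed

section \<open>The differential of the Cahn-Hoffman map\<close>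

text \<open>The Riesz representative of a linear functional.\<close>

definition riesz :: "('a::euclidean_space \<Rightarrow>\<^sub>L real) \<Rightarrow> 'a" where
  "riesz \<phi> = (\<Sum>b\<in>Basis. \<phi> b *\<^sub>R b)"

lemma inner_riesz [simp]: "riesz \<phi> \<bullet> h = \<phi> h"
proof -
  have "riesz \<phi> \<bullet> h = (\<Sum>b\<in>Basis. (h \<bullet> b) * \<phi> b)"
    by (simp add: riesz_def inner_sum_left inner_commute[of h] mult.commute)
  also have "\<dots> = \<phi> (\<Sum>b\<in>Basis. (h \<bullet> b) *\<^sub>R b)"
    by (simp add: blinfun.sum_right blinfun.scaleR_right)
  finally show ?thesis by (simp add: euclidean_representation)
qed

lemma bounded_linear_riesz: "bounded_linear riesz"
  unfolding riesz_def by (intro bounded_linear_intros)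

text \<open>The gradient on the sphere is the tangential part of the gradient of an ambient extension.\<close>

lemma sphere_gradient_extension:
  fixes \<gamma> :: "'a::euclidean_space \<Rightarrow> real"
  assumes \<nu>: "\<nu> \<in> sphere 0 1" and U: "open U" "\<nu> \<in> U"
    and g: "(g has_derivative blinfun_apply \<phi>) (at \<nu>)" and eq: "\<And>x. x \<in> U \<inter> sphere 0 1 \<Longrightarrow> g x = \<gamma> x"
  shows "sphere_gradient \<gamma> \<nu> = riesz \<phi> - \<phi> \<nu> *\<^sub>R \<nu>"
    and "(\<gamma> has_derivative (\<lambda>h. sphere_gradient \<gamma> \<nu> \<bullet> h)) (at \<nu> within sphere 0 1)"
proof -
  define w where "w = riesz \<phi> - \<phi> \<nu> *\<^sub>R \<nu>"
  have n: "norm \<nu> = 1" using \<nu> by simp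
  have w: "w \<in> sphere_tangent_space \<nu>"
    using n by (simp add: w_def sphere_tangent_space_def inner_diff_left dot_square_norm)
  have "(\<gamma> has_derivative \<phi>) (at \<nu> within sphere 0 1)"
    using has_derivative_at_withinI[OF g]
  proof (rule has_derivative_transform_eventually)
    show "\<forall>\<^sub>F x in at \<nu> within sphere 0 1. g x = \<gamma> x"
      using U eq by (auto simp: eventually_at_topological)
  qed (use \<nu> U eq in auto)
  from has_derivative_sphere_tangential[OF n this]
  have der: "(\<gamma> has_derivative (\<lambda>h. w \<bullet> h)) (at \<nu> within sphere 0 1)"
    by (simp add: w_def inner_diff_left blinfun.diff_right blinfun.scaleR_right inner_commute[of \<nu>] mult.commute)
  have "sphere_gradient \<gamma> \<nu> = w" unfolding sphere_gradient_def
  proof (rule the_equality)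
    fix v assume v: "v \<in> sphere_tangent_space \<nu> \<and>
        (\<gamma> has_derivative (\<lambda>h. v \<bullet> h)) (at \<nu> within sphere 0 1)"
    have "v - w \<in> sphere_tangent_space \<nu>"
      using v w by (simp add: sphere_tangent_space_def inner_diff_left)
    from has_derivative_sphere_unique[OF n _ der this, of "\<lambda>h. v \<bullet> h"] v
    have "(v - w) \<bullet> (v - w) = 0" by (simp add: inner_diff_left)
    then show "v = w" by simp
  qed (use w der in auto)
  then show "sphere_gradient \<gamma> \<nu> = riesz \<phi> - \<phi> \<nu> *\<^sub>R \<nu>"
    and "(\<gamma> has_derivative (\<lambda>h. sphere_gradient \<gamma> \<nu> \<bullet> h)) (at \<nu> within sphere 0 1)"
    using der by (simp_all add: w_def)
qed

locale C2_sphere_function =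
  fixes \<gamma> :: "'a::euclidean_space \<Rightarrow> real"
  assumes C2: "C2_on_sphere \<gamma>"
begin

lemma local_extension:
  assumes "\<nu> \<in> sphere 0 1"
  obtains U g and g' :: "'a \<Rightarrow> 'a \<Rightarrow>\<^sub>L real" and g'' :: "'a \<Rightarrow> 'a \<Rightarrow>\<^sub>L 'a \<Rightarrow>\<^sub>L real"
  where "open U" "\<nu> \<in> U" "\<And>x. x \<in> U \<Longrightarrow> (g has_derivative g' x) (at x)"
    "\<And>x. x \<in> U \<Longrightarrow> (g' has_derivative g'' x) (at x)" "continuous_on U g''"
    "\<And>x. x \<in> U \<inter> sphere 0 1 \<Longrightarrow> g x = \<gamma> x"
proof -
  obtain U g where Ug: "open U \<and> \<nu> \<in> U \<and> twice_continuously_differentiable_on U g \<and>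
      (\<forall>x\<in>U \<inter> sphere 0 1. g x = \<gamma> x)"
    using bspec[OF C2[unfolded C2_on_sphere_def] assms] by (elim exE)
  then have U: "open U" "\<nu> \<in> U" and g: "twice_continuously_differentiable_on U g"
    and eq: "\<And>x. x \<in> U \<inter> sphere 0 1 \<Longrightarrow> g x = \<gamma> x"
    by simp_all
  obtain g' :: "'a \<Rightarrow> 'a \<Rightarrow>\<^sub>L real"
    where g': "\<And>x. x \<in> U \<Longrightarrow> (g has_derivative g' x) (at x)" "continuously_differentiable_on U g'"
    using g unfolding twice_continuously_differentiable_on_def by blast
  obtain g'' :: "'a \<Rightarrow> 'a \<Rightarrow>\<^sub>L 'a \<Rightarrow>\<^sub>L real"
    where g'': "\<And>x. x \<in> U \<Longrightarrow> (g' has_derivative g'' x) (at x)" "continuous_on U g''"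
    using g'(2) unfolding continuously_differentiable_on_def by blast
  show thesis by (rule that[OF U g'(1) g'' eq])
qed

lemma has_derivative_sphere_gradient:
  assumes "\<nu> \<in> sphere 0 1"
  shows "(\<gamma> has_derivative (\<lambda>h. sphere_gradient \<gamma> \<nu> \<bullet> h)) (at \<nu> within sphere 0 1)"
    and "sphere_gradient \<gamma> \<nu> \<bullet> \<nu> = 0"
proof -
  obtain U g and g' :: "'a \<Rightarrow> 'a \<Rightarrow>\<^sub>L real" and g'' :: "'a \<Rightarrow> 'a \<Rightarrow>\<^sub>L 'a \<Rightarrow>\<^sub>L real"
    where U: "open U" "\<nu> \<in> U" and "\<And>x. x \<in> U \<Longrightarrow> (g has_derivative g' x) (at x)"
      and eq: "\<And>x. x \<in> U \<inter> sphere 0 1 \<Longrightarrow> g x = \<gamma> x"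
    using local_extension[OF assms] by metis
  then have g: "(g has_derivative g' \<nu>) (at \<nu>)" by blast
  have gradient: "sphere_gradient \<gamma> \<nu> = riesz (g' \<nu>) - g' \<nu> \<nu> *\<^sub>R \<nu>"
    by (rule sphere_gradient_extension(1)[OF assms U g eq])
  show "(\<gamma> has_derivative (\<lambda>h. sphere_gradient \<gamma> \<nu> \<bullet> h)) (at \<nu> within sphere 0 1)"
    by (rule sphere_gradient_extension(2)[OF assms U g eq])
  show "sphere_gradient \<gamma> \<nu> \<bullet> \<nu> = 0"
    unfolding gradient using assms by (simp add: inner_diff_left dot_square_norm)
qed

lemma inner_cahn_hoffman_self:
  assumes "\<nu> \<in> sphere 0 1"
  shows "cahn_hoffman \<gamma> \<nu> \<bullet> \<nu> = \<gamma> \<nu>"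
  using has_derivative_sphere_gradient(2)[OF assms] assms
  by (simp add: cahn_hoffman_def inner_add_left dot_square_norm)

text \<open>
  An ambient \<open>C\<^sup>2\<close> extension \<open>g\<close> of \<open>\<gamma>\<close> gives the \<open>C\<^sup>1\<close> extension
  \<open>x \<mapsto> \<nabla>g x - (\<nabla>g x \<bullet> x) x + g x x\<close> of the Cahn-Hoffman map. At a point \<open>x\<close> of the sphere, its
  derivative in a tangent direction \<open>h\<close> is the tangential part of the Hessian of \<open>g\<close> applied to
  \<open>h\<close>, plus a multiple of \<open>h\<close>; this is why it is tangential and symmetric.
\<close>

lemma cahn_hoffman_local_extension:
  assumes "\<nu> \<in> sphere 0 1"
  obtains U G and G' :: "'a \<Rightarrow> 'a \<Rightarrow>\<^sub>L 'a"
  where "open U" "\<nu> \<in> U" "\<And>x. x \<in> U \<Longrightarrow> (G has_derivative G' x) (at x)" "continuous_on U G'"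
    "\<And>x. x \<in> U \<inter> sphere 0 1 \<Longrightarrow> cahn_hoffman \<gamma> x = G x"
    "\<And>x u. x \<in> U \<inter> sphere 0 1 \<Longrightarrow> u \<in> sphere_tangent_space x \<Longrightarrow> G' x u \<bullet> x = 0"
    "\<And>x u v. x \<in> U \<inter> sphere 0 1 \<Longrightarrow> u \<in> sphere_tangent_space x \<Longrightarrow> v \<in> sphere_tangent_space x
       \<Longrightarrow> G' x u \<bullet> v = G' x v \<bullet> u"
proof -
  obtain U g and g' :: "'a \<Rightarrow> 'a \<Rightarrow>\<^sub>L real" and g'' :: "'a \<Rightarrow> 'a \<Rightarrow>\<^sub>L 'a \<Rightarrow>\<^sub>L real"
    where U: "open U" "\<nu> \<in> U" and g: "\<And>x. x \<in> U \<Longrightarrow> (g has_derivative g' x) (at x)"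
      and g': "\<And>x. x \<in> U \<Longrightarrow> (g' has_derivative g'' x) (at x)" and cont: "continuous_on U g''"
      and eq: "\<And>x. x \<in> U \<inter> sphere 0 1 \<Longrightarrow> g x = \<gamma> x"
    using local_extension[OF assms] by metis
  define G where "G x = riesz (g' x) - g' x x *\<^sub>R x + g x *\<^sub>R x" for x
  define D where "D x h = riesz (g'' x h) - g'' x h x *\<^sub>R x + (g x - g' x x) *\<^sub>R h" for x h
  define G' where "G' x = Blinfun (D x)" for x
  have D: "(G has_derivative D x) (at x)" if "x \<in> U" for x
  proof -
    have "((\<lambda>x. riesz (g' x)) has_derivative (\<lambda>h. riesz (g'' x h))) (at x)"
      by (rule bounded_linear.has_derivative[OF bounded_linear_riesz g'[OF that]])
    moreover have "((\<lambda>x. g' x x) has_derivative (\<lambda>h. g' x h + g'' x h x)) (at x)"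
      by (rule blinfun.FDERIV[OF g'[OF that] has_derivative_ident])
    ultimately have "(G has_derivative (\<lambda>h. riesz (g'' x h) - (g' x x *\<^sub>R h + (g' x h + g'' x h x) *\<^sub>R x)
        + (g x *\<^sub>R h + g' x h *\<^sub>R x))) (at x)"
      unfolding G_def
      by (intro has_derivative_add has_derivative_diff has_derivative_scaleR has_derivative_ident g that)
    then show ?thesis
      by (rule has_derivative_eq_rhs) (auto simp: D_def algebra_simps)
  qed
  have G'_apply: "G' x h = D x h" if "x \<in> U" for x h
    using bounded_linear_Blinfun_apply[OF has_derivative_bounded_linear[OF D[OF that]]]
    by (simp add: G'_def)
  show thesis
  proof (rule that[OF U, of G G'])
    show "(G has_derivative G' x) (at x)" if "x \<in> U" for x
    proof -
      have "blinfun_apply (G' x) = D x" using G'_apply[OF that] by auto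
      then show ?thesis using D[OF that] by simp
    qed
    have cg: "continuous_on U g" "continuous_on U g'"
      using g g' U by (auto intro!: continuous_at_imp_continuous_on has_derivative_continuous)
    have "continuous_on U (\<lambda>x. D x i)" for i
      unfolding D_def
      by (intro continuous_intros bounded_linear.continuous_on[OF bounded_linear_riesz] cont cg)
    then show "continuous_on U G'"
      by (intro continuous_on_blinfun_componentwise) (simp add: G'_apply cong: continuous_on_cong_simp)
    fix x assume x: "x \<in> U \<inter> sphere 0 1"
    have xx: "x \<bullet> x = 1" using x by (simp add: dot_square_norm)
    have xU: "x \<in> U" using x by simp
    show "cahn_hoffman \<gamma> x = G x"
      using sphere_gradient_extension(1)[OF _ U(1) xU g[OF xU] eq] x eq[of x]
      by (simp add: cahn_hoffman_def G_def)
    fix u assume u: "u \<in> sphere_tangent_space x"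
    show "G' x u \<bullet> x = 0"
      using u xx by (simp add: G'_apply[OF xU] D_def sphere_tangent_space_def algebra_simps)
    fix v assume v: "v \<in> sphere_tangent_space x"
    show "G' x u \<bullet> v = G' x v \<bullet> u"
      using u v second_derivative_symmetric[OF U(1) xU g g'[OF xU], of u v]
      by (simp add: G'_apply[OF xU] D_def sphere_tangent_space_def inner_add_left inner_diff_left
          inner_commute[of v u] inner_commute[of x])
  qed
qed

text \<open>
  A derivative within the sphere is only determined on tangent vectors. Requiring the normal
  vector to be mapped to \<open>0\<close> makes it unique, and continuous in \<open>\<nu>\<close> as a linear map of the
  ambient space.
\<close>

definition differential :: "'a \<Rightarrow> 'a \<Rightarrow>\<^sub>L 'a" where
  "differential \<nu> = (SOME D. (cahn_hoffman \<gamma> has_derivative blinfun_apply D) (at \<nu> within sphere 0 1) \<and>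
     blinfun_apply D \<nu> = 0)"

lemma differential_extension:
  assumes x: "x \<in> sphere 0 1" and U: "open U" "x \<in> U"
    and G: "(G has_derivative blinfun_apply L) (at x)"
    and eq: "\<And>y. y \<in> U \<inter> sphere 0 1 \<Longrightarrow> cahn_hoffman \<gamma> y = G y"
  shows "(cahn_hoffman \<gamma> has_derivative differential x) (at x within sphere 0 1)"
    and "differential x h = L (h - (h \<bullet> x) *\<^sub>R x)"
proof -
  have n: "norm x = 1" using x by simp
  have "(cahn_hoffman \<gamma> has_derivative L) (at x within sphere 0 1)"
    using has_derivative_at_withinI[OF G]
  proof (rule has_derivative_transform_eventually)
    show "\<forall>\<^sub>F y in at x within sphere 0 1. G y = cahn_hoffman \<gamma> y"
      using U eq by (auto simp: eventually_at_topological)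
  qed (use x U eq in auto)
  from has_derivative_sphere_tangential[OF n this]
  have der: "(cahn_hoffman \<gamma> has_derivative (\<lambda>h. L (h - (h \<bullet> x) *\<^sub>R x))) (at x within sphere 0 1)" .
  have "blinfun_apply (Blinfun (\<lambda>h. L (h - (h \<bullet> x) *\<^sub>R x))) = (\<lambda>h. L (h - (h \<bullet> x) *\<^sub>R x))"
    by (rule bounded_linear_Blinfun_apply[OF has_derivative_bounded_linear[OF der]])
  then have "\<exists>D. (cahn_hoffman \<gamma> has_derivative blinfun_apply D) (at x within sphere 0 1) \<and>
      blinfun_apply D x = 0"
    using der n by (intro exI[of _ "Blinfun (\<lambda>h. L (h - (h \<bullet> x) *\<^sub>R x))"]) (simp add: dot_square_norm)
  from someI_ex[OF this] have D: "(cahn_hoffman \<gamma> has_derivative differential x) (at x within sphere 0 1)"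
      "differential x x = 0"
    by (auto simp: differential_def)
  show "(cahn_hoffman \<gamma> has_derivative differential x) (at x within sphere 0 1)" by (rule D)
  define v where "v = h - (h \<bullet> x) *\<^sub>R x"
  have v: "v \<in> sphere_tangent_space x"
    using n by (simp add: v_def sphere_tangent_space_def inner_diff_left dot_square_norm)
  have "differential x h = differential x v"
    using D(2) by (simp add: v_def blinfun.diff_right blinfun.scaleR_right)
  also have "\<dots> = L (v - (v \<bullet> x) *\<^sub>R x)"
    by (rule has_derivative_sphere_unique[OF n D(1) der v])
  also have "\<dots> = L v" using v by (simp add: sphere_tangent_space_def)
  finally show "differential x h = L (h - (h \<bullet> x) *\<^sub>R x)" by (simp add: v_def)
qed

lemma has_derivative_cahn_hoffman:
  assumes "\<nu> \<in> sphere 0 1"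
  shows "(cahn_hoffman \<gamma> has_derivative differential \<nu>) (at \<nu> within sphere 0 1)"
  by (rule cahn_hoffman_local_extension[OF assms]) (metis assms differential_extension(1))

lemma continuous_on_cahn_hoffman: "continuous_on (sphere 0 1) (cahn_hoffman \<gamma>)"
  using has_derivative_cahn_hoffman has_derivative_continuous continuous_on_eq_continuous_within by blast

lemma differential_props:
  assumes \<nu>: "\<nu> \<in> sphere 0 1"
  shows differential_tangential: "differential \<nu> h \<bullet> \<nu> = 0"
    and differential_normal: "differential \<nu> \<nu> = 0"
    and differential_symmetric: "differential \<nu> h \<bullet> k = differential \<nu> k \<bullet> h"
proof -
  obtain U G and G' :: "'a \<Rightarrow> 'a \<Rightarrow>\<^sub>L 'a"
    where U: "open U" "\<nu> \<in> U" and G: "(G has_derivative G' \<nu>) (at \<nu>)"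
    and eq: "\<And>x. x \<in> U \<inter> sphere 0 1 \<Longrightarrow> cahn_hoffman \<gamma> x = G x"
    and tan: "\<And>u. u \<in> sphere_tangent_space \<nu> \<Longrightarrow> G' \<nu> u \<bullet> \<nu> = 0"
    and sym: "\<And>u v. u \<in> sphere_tangent_space \<nu> \<Longrightarrow> v \<in> sphere_tangent_space \<nu>
       \<Longrightarrow> G' \<nu> u \<bullet> v = G' \<nu> v \<bullet> u"
    by (rule cahn_hoffman_local_extension[OF \<nu>]) (metis IntI \<nu>)
  have nn: "\<nu> \<bullet> \<nu> = 1" using \<nu> by (simp add: dot_square_norm)
  have D: "differential \<nu> h = G' \<nu> (h - (h \<bullet> \<nu>) *\<^sub>R \<nu>)" for h
    by (rule differential_extension(2)[OF \<nu> U G eq])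
  have P: "h - (h \<bullet> \<nu>) *\<^sub>R \<nu> \<in> sphere_tangent_space \<nu>" for h
    using nn by (simp add: sphere_tangent_space_def inner_diff_left)
  show 1: "differential \<nu> h \<bullet> \<nu> = 0" for h using tan[OF P] by (simp add: D)
  show "differential \<nu> \<nu> = 0" by (simp add: D nn)
  have "differential \<nu> h \<bullet> k = differential \<nu> h \<bullet> (k - (k \<bullet> \<nu>) *\<^sub>R \<nu>)" for h k
    by (simp add: inner_diff_right 1)
  then show "differential \<nu> h \<bullet> k = differential \<nu> k \<bullet> h" using sym[OF P P] by (simp add: D)
qed

lemma continuous_on_differential: "continuous_on (sphere 0 1) differential"
proof (rule continuous_on_blinfun_componentwise, unfold continuous_on_eq_continuous_within, rule ballI)
  fix i \<nu> :: 'a assume \<nu>: "\<nu> \<in> sphere 0 1"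
  obtain U G and G' :: "'a \<Rightarrow> 'a \<Rightarrow>\<^sub>L 'a"
    where U: "open U" "\<nu> \<in> U" and G: "\<And>x. x \<in> U \<Longrightarrow> (G has_derivative G' x) (at x)"
    and cont: "continuous_on U G'"
    and eq: "\<And>x. x \<in> U \<inter> sphere 0 1 \<Longrightarrow> cahn_hoffman \<gamma> x = G x"
    using cahn_hoffman_local_extension[OF \<nu>] by metis
  have "continuous_on U (\<lambda>x. G' x (i - (i \<bullet> x) *\<^sub>R x))"
    by (intro continuous_intros cont)
  then have "isCont (\<lambda>x. G' x (i - (i \<bullet> x) *\<^sub>R x)) \<nu>"
    using U continuous_on_eq_continuous_at by blast
  then have "continuous (at \<nu> within sphere 0 1) (\<lambda>x. G' x (i - (i \<bullet> x) *\<^sub>R x))"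
    by (rule continuous_at_imp_continuous_at_within)
  moreover have "\<forall>\<^sub>F x in at \<nu> within sphere 0 1. G' x (i - (i \<bullet> x) *\<^sub>R x) = differential x i"
    using U differential_extension(2)[OF _ U(1) _ G eq] by (auto simp: eventually_at_topological)
  moreover have "differential \<nu> i = G' \<nu> (i - (i \<bullet> \<nu>) *\<^sub>R \<nu>)"
    by (rule differential_extension(2)[OF \<nu> U G[OF U(2)] eq])
  ultimately show "continuous (at \<nu> within sphere 0 1) (\<lambda>x. differential x i)"
    by (simp add: continuous_within Lim_transform_eventually)
qed

lemma immersion_iff:
  assumes \<nu>: "\<nu> \<in> sphere 0 1"
  shows "sphere_immersion_at (cahn_hoffman \<gamma>) \<nu> \<longleftrightarrow>
     (\<forall>v\<in>sphere_tangent_space \<nu>. differential \<nu> v = 0 \<longrightarrow> v = 0)"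
proof -
  have n: "norm \<nu> = 1" using \<nu> by simp
  have "sphere_immersion_at (cahn_hoffman \<gamma>) \<nu> \<longleftrightarrow> inj_on (differential \<nu>) (sphere_tangent_space \<nu>)"
    unfolding sphere_immersion_at_def
    using has_derivative_cahn_hoffman[OF \<nu>] has_derivative_sphere_unique[OF n _ has_derivative_cahn_hoffman[OF \<nu>]]
      inj_on_cong by metis
  also have "\<dots> \<longleftrightarrow> (\<forall>v\<in>sphere_tangent_space \<nu>. differential \<nu> v = 0 \<longrightarrow> v = 0)"
  proof (rule linear_inj_on_iff_eq_0)
    show "linear (differential \<nu>)" by (simp add: bounded_linear.linear blinfun.bounded_linear_right)
    show "subspace (sphere_tangent_space \<nu>)"
      by (auto simp: sphere_tangent_space_def subspace_def inner_add_left)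
  qed
  finally show ?thesis .
qed

end

section \<open>The smallest principal curvature\<close>

context C2_sphere_function
begin

lemma symmetric_differential:
  assumes \<nu>: "\<nu> \<in> sphere 0 1"
  shows "symmetric_on_subspace (sphere_tangent_space \<nu>) (differential \<nu>)"
proof (rule symmetric_on_subspace.intro)
  show "subspace (sphere_tangent_space \<nu>)"
    by (auto simp: sphere_tangent_space_def subspace_def inner_add_left)
  show "linear (differential \<nu>)" by (simp add: bounded_linear.linear blinfun.bounded_linear_right)
  show "differential \<nu> v \<in> sphere_tangent_space \<nu>" if "v \<in> sphere_tangent_space \<nu>" for v
    using differential_tangential[OF \<nu>] by (simp add: sphere_tangent_space_def)
qed (rule differential_symmetric[OF \<nu>])

text \<open>
  Adding the identity on the normal line turns the differential into a map of the ambient space,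
  where injectivity gives surjectivity and an inverse.
\<close>

lemma differential_plus_normal_inj:
  assumes \<nu>: "\<nu> \<in> sphere 0 1" and reg: "sphere_immersion_at (cahn_hoffman \<gamma>) \<nu>"
  shows "inj (\<lambda>h. differential \<nu> h + (h \<bullet> \<nu>) *\<^sub>R \<nu>)" (is "inj ?\<Phi>")
    and "linear (\<lambda>h. differential \<nu> h + (h \<bullet> \<nu>) *\<^sub>R \<nu>)"
proof -
  show lin: "linear ?\<Phi>"
    by (intro linearI) (auto simp: blinfun.add_right blinfun.scaleR_right inner_add_left algebra_simps)
  show "inj ?\<Phi>"
  proof (subst linear_injective_0[OF lin], intro allI impI)
    fix h assume h: "?\<Phi> h = 0"
    then have "?\<Phi> h \<bullet> \<nu> = 0" by simp
    then have "h \<bullet> \<nu> = 0"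
      using \<nu> by (auto simp: inner_add_left differential_tangential[OF \<nu>] dot_square_norm)
    then show "h = 0"
      using h reg by (simp add: immersion_iff[OF \<nu>] sphere_tangent_space_def)
  qed
qed

lemma differential_surj_tangent:
  assumes \<nu>: "\<nu> \<in> sphere 0 1" and reg: "sphere_immersion_at (cahn_hoffman \<gamma>) \<nu>"
    and u: "u \<in> sphere_tangent_space \<nu>"
  obtains v where "v \<in> sphere_tangent_space \<nu>" "u = differential \<nu> v"
proof -
  have "surj (\<lambda>h. differential \<nu> h + (h \<bullet> \<nu>) *\<^sub>R \<nu>)"
    by (intro linear_inj_imp_surj differential_plus_normal_inj[OF \<nu> reg])
  from surjD[OF this, of u] obtain v where v: "u = differential \<nu> v + (v \<bullet> \<nu>) *\<^sub>R \<nu>" ..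
  then have "u \<bullet> \<nu> = v \<bullet> \<nu>"
    using \<nu> by (simp add: inner_add_left differential_tangential[OF \<nu>] dot_square_norm)
  then have "v \<bullet> \<nu> = 0" using u by (simp add: sphere_tangent_space_def)
  then show thesis using that v by (simp add: sphere_tangent_space_def)
qed

text \<open>The chain rule for the identity \<open>N (cahn_hoffman \<gamma> \<mu>) = \<mu>\<close>.\<close>

lemma unit_normal_derivative_inverse:
  assumes \<nu>: "\<nu> \<in> sphere 0 1" and A: "unit_normal_has_derivative \<gamma> \<nu> A"
    and v: "v \<in> sphere_tangent_space \<nu>"
  shows "A (differential \<nu> v) = v"
proof -
  have n: "norm \<nu> = 1" using \<nu> by simp
  obtain V N where V: "open V" "\<nu> \<in> V"
    and N: "\<And>\<mu>. \<mu> \<in> V \<inter> sphere 0 1 \<Longrightarrow> N (cahn_hoffman \<gamma> \<mu>) = \<mu>"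
    and der: "(N has_derivative A) (at (cahn_hoffman \<gamma> \<nu>) within cahn_hoffman \<gamma> ` (V \<inter> sphere 0 1))"
    using A unfolding unit_normal_has_derivative_def by blast
  have within: "at \<nu> within (V \<inter> sphere 0 1) = at \<nu> within sphere 0 1"
    by (rule at_within_nhd[of _ V]) (use V in auto)
  have "(cahn_hoffman \<gamma> has_derivative differential \<nu>) (at \<nu> within V \<inter> sphere 0 1)"
    unfolding within by (rule has_derivative_cahn_hoffman[OF \<nu>])
  from has_derivative_in_compose[OF this der]
  have "((\<lambda>\<mu>. N (cahn_hoffman \<gamma> \<mu>)) has_derivative (\<lambda>h. A (differential \<nu> h))) (at \<nu> within V \<inter> sphere 0 1)" .
  then have "((\<lambda>\<mu>. \<mu>) has_derivative (\<lambda>h. A (differential \<nu> h))) (at \<nu> within V \<inter> sphere 0 1)"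
    by (rule has_derivative_transform[rotated 2]) (use N V \<nu> in auto)
  then show ?thesis
    unfolding within using has_derivative_sphere_unique[OF n _ has_derivative_ident v] by blast
qed

text \<open>
  The inverse function theorem needs a map between spaces of equal dimension. The extension \<open>F\<close>
  of the Cahn-Hoffman map below is chosen to have an invertible derivative at \<open>\<nu>\<close>; a local inverse
  of \<open>F\<close> then serves as the unit normal field.
\<close>

lemma unit_normal_derivative_exists:
  assumes \<nu>: "\<nu> \<in> sphere 0 1" and reg: "sphere_immersion_at (cahn_hoffman \<gamma>) \<nu>"
  shows "\<exists>A. unit_normal_has_derivative \<gamma> \<nu> A"
proof -
  have nn: "\<nu> \<bullet> \<nu> = 1" using \<nu> by (simp add: dot_square_norm)
  obtain U G and G' :: "'a \<Rightarrow> 'a \<Rightarrow>\<^sub>L 'a"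
    where U: "open U" "\<nu> \<in> U" and G: "\<And>x. x \<in> U \<Longrightarrow> (G has_derivative G' x) (at x)"
    and cont: "continuous_on U G'"
    and eq: "\<And>x. x \<in> U \<inter> sphere 0 1 \<Longrightarrow> cahn_hoffman \<gamma> x = G x"
    using cahn_hoffman_local_extension[OF \<nu>] by metis
  \<comment> \<open>The factor \<open>x \<bullet> x - 1\<close> vanishes on the sphere and has derivative \<open>2\<close> in the direction \<open>\<nu>\<close>;
    \<open>w\<close> is such that the derivative of \<open>F\<close> fixes \<open>\<nu>\<close>.\<close>
  define w where "w = (1/2) *\<^sub>R (\<nu> - G' \<nu> \<nu>)"
  define F where "F x = G x + (x \<bullet> x - 1) *\<^sub>R w" for x
  define D where "D x h = G' x h + (2 * (x \<bullet> h)) *\<^sub>R w" for x h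
  define F' where "F' x = Blinfun (D x)" for x
  have D: "(F has_derivative D x) (at x)" if "x \<in> U" for x
    unfolding F_def D_def
    by (auto intro!: derivative_eq_intros G that simp: inner_commute)
  have F'_apply: "blinfun_apply (F' x) = D x" if "x \<in> U" for x
    using bounded_linear_Blinfun_apply[OF has_derivative_bounded_linear[OF D[OF that]]]
    by (simp add: F'_def)
  have F'_cont: "continuous_on U F'"
  proof (rule continuous_on_blinfun_componentwise)
    fix i :: 'a
    have "continuous_on U (\<lambda>x. D x i)" unfolding D_def by (intro continuous_intros cont)
    then show "continuous_on U (\<lambda>x. F' x i)" by (simp add: F'_apply cong: continuous_on_cong_simp)
  qed
  have D\<nu>: "D \<nu> h = differential \<nu> h + (h \<bullet> \<nu>) *\<^sub>R \<nu>" for h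
    using differential_extension(2)[OF \<nu> U G[OF U(2)] eq, of h]
    by (simp add: D_def w_def blinfun.diff_right blinfun.scaleR_right inner_commute[of \<nu>] algebra_simps)
  obtain g where g: "linear g" "g \<circ> D \<nu> = id"
    using linear_injective_left_inverse[of "D \<nu>"] differential_plus_normal_inj[OF \<nu> reg]
    by (auto simp: D\<nu>[abs_def])
  have "blinfun_apply (Blinfun g) = g"
    using g(1) by (intro bounded_linear_Blinfun_apply) (simp add: linear_conv_bounded_linear)
  then have inv: "Blinfun g o\<^sub>L F' \<nu> = id_blinfun"
    using g(2) by (intro blinfun_eqI) (simp add: F'_apply[OF U(2)] fun_eq_iff)
  obtain U' V N N' where U': "open U'" "U' \<subseteq> U" "\<nu> \<in> U'" and V: "F \<nu> \<in> V"
    and hom: "homeomorphism U' V F N" and N: "\<And>y. y \<in> V \<Longrightarrow> (N has_derivative N' y) (at y)"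
    using inverse_function_theorem[OF U(1) _ F'_cont U(2) inv, of F] D F'_apply by metis
  have F: "F x = cahn_hoffman \<gamma> x" if "x \<in> U' \<inter> sphere 0 1" for x
    using that U' eq[of x] by (auto simp: F_def dot_square_norm)
  show ?thesis unfolding unit_normal_has_derivative_def
  proof (intro exI conjI ballI)
    show "N (cahn_hoffman \<gamma> \<mu>) = \<mu>" if "\<mu> \<in> U' \<inter> sphere 0 1" for \<mu>
      using F[OF that] hom that by (metis IntD1 homeomorphism_apply1)
    show "(N has_derivative N' (F \<nu>)) (at (cahn_hoffman \<gamma> \<nu>) within cahn_hoffman \<gamma> ` (U' \<inter> sphere 0 1))"
      using N[OF V] F[of \<nu>] U' \<nu> by (auto intro: has_derivative_at_withinI)
  qed (use U' in auto)
qed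

lemma shape_operator_differential:
  assumes \<nu>: "\<nu> \<in> sphere 0 1" and reg: "sphere_immersion_at (cahn_hoffman \<gamma>) \<nu>"
    and v: "v \<in> sphere_tangent_space \<nu>"
  shows "shape_operator \<gamma> \<nu> (differential \<nu> v) = - v"
  unfolding shape_operator_def
  using unit_normal_derivative_inverse[OF \<nu> someI_ex[OF unit_normal_derivative_exists[OF \<nu> reg]] v]
  by simp

text \<open>
  An eigenvector of the differential for its smallest eigenvalue \<open>\<rho>\<close> is an eigenvector of the shape
  operator for \<open>-1/\<rho>\<close>, so \<open>-1/\<rho>\<close> occurs in the sorted list of principal curvatures and bounds its
  first entry from above.
\<close>

lemma first_principal_curvature_bound:
  assumes \<nu>: "\<nu> \<in> sphere 0 1" and reg: "sphere_immersion_at (cahn_hoffman \<gamma>) \<nu>"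
    and psd: "\<And>v. v \<in> sphere_tangent_space \<nu> \<Longrightarrow> differential \<nu> v \<bullet> v \<ge> 0"
    and nontrivial: "\<not> sphere_tangent_space \<nu> \<subseteq> {0}"
  obtains \<rho> where "\<rho> > 0" "\<And>w. w \<in> sphere_tangent_space \<nu> \<Longrightarrow> differential \<nu> w \<bullet> w \<ge> \<rho> * (w \<bullet> w)"
    "principal_curvatures \<gamma> \<nu> ! 0 \<le> - 1 / \<rho>"
proof -
  let ?T = "sphere_tangent_space \<nu>"
  interpret symmetric_on_subspace ?T "differential \<nu>" by (rule symmetric_differential[OF \<nu>])
  obtain \<rho> v where v: "v \<in> ?T" "v \<noteq> 0" "differential \<nu> v = \<rho> *\<^sub>R v"
    and min: "\<And>w. w \<in> ?T \<Longrightarrow> differential \<nu> w \<bullet> w \<ge> \<rho> * (w \<bullet> w)"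
    using smallest_eigenvalue[OF nontrivial] by metis
  have "\<rho> \<noteq> 0" using reg v by (auto simp: immersion_iff[OF \<nu>])
  moreover have "\<rho> \<ge> 0"
  proof -
    have "v \<bullet> v > 0" using v(2) by simp
    moreover have "\<rho> * (v \<bullet> v) \<ge> 0" using psd[OF v(1)] by (simp add: v(3))
    ultimately show ?thesis by (simp only: zero_le_mult_iff) linarith
  qed
  ultimately have "\<rho> > 0" by simp
  define E where "E \<kappa> = {u \<in> ?T. shape_operator \<gamma> \<nu> u = \<kappa> *\<^sub>R u}" for \<kappa>
  \<comment> \<open>Eigenvalues of the shape operator are negative reciprocals of those of the differential, hence
    finite in number.\<close>
  have "{\<kappa>. dim (E \<kappa>) \<noteq> 0} \<subseteq> (\<lambda>\<mu>. - 1 / \<mu>) ` {\<mu>. \<exists>u\<in>?T. u \<noteq> 0 \<and> differential \<nu> u = \<mu> *\<^sub>R u}"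
  proof
    fix \<kappa> assume "\<kappa> \<in> {\<kappa>. dim (E \<kappa>) \<noteq> 0}"
    then obtain u where u: "u \<in> ?T" "u \<noteq> 0" "shape_operator \<gamma> \<nu> u = \<kappa> *\<^sub>R u" by (auto simp: E_def)
    obtain x where x: "x \<in> ?T" "u = differential \<nu> x"
      using differential_surj_tangent[OF \<nu> reg u(1)] .
    then have "x = (- \<kappa>) *\<^sub>R u" using shape_operator_differential[OF \<nu> reg x(1)] u(3)
      by (metis minus_minus scaleR_minus_left)
    with x(2) have eq: "u = (- \<kappa>) *\<^sub>R differential \<nu> u" by (metis blinfun.scaleR_right)
    then have "\<kappa> \<noteq> 0" using u(2) by auto
    have "differential \<nu> u = (- 1 / \<kappa>) *\<^sub>R ((- \<kappa>) *\<^sub>R differential \<nu> u)" using \<open>\<kappa> \<noteq> 0\<close> by simp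
    then have "differential \<nu> u = (- 1 / \<kappa>) *\<^sub>R u" by (simp only: flip: eq)
    then show "\<kappa> \<in> (\<lambda>\<mu>. - 1 / \<mu>) ` {\<mu>. \<exists>u\<in>?T. u \<noteq> 0 \<and> differential \<nu> u = \<mu> *\<^sub>R u}"
      using u \<open>\<kappa> \<noteq> 0\<close> by (intro image_eqI[of _ _ "- 1 / \<kappa>"]) auto
  qed
  then have "finite {\<kappa>. dim (E \<kappa>) \<noteq> 0}" using finite_eigenvalues finite_surj by blast
  from theI'[OF ex1_sorted_list_with_counts[OF this]]
  have ks: "sorted (principal_curvatures \<gamma> \<nu>)"
    "\<And>\<kappa>. count_list (principal_curvatures \<gamma> \<nu>) \<kappa> = dim (E \<kappa>)"
    by (auto simp: principal_curvatures_def E_def)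
  have "shape_operator \<gamma> \<nu> (differential \<nu> ((1 / \<rho>) *\<^sub>R v)) = - ((1 / \<rho>) *\<^sub>R v)"
    by (intro shape_operator_differential[OF \<nu> reg] subspace_scale subspace v)
  then have "shape_operator \<gamma> \<nu> v = (- 1 / \<rho>) *\<^sub>R v"
    using v(3) \<open>\<rho> > 0\<close> by (simp add: blinfun.scaleR_right)
  then have "dim (E (- 1 / \<rho>)) \<noteq> 0" using v by (auto simp: E_def)
  then have "- 1 / \<rho> \<in> set (principal_curvatures \<gamma> \<nu>)" using ks(2) by (metis count_list_0_iff)
  then have "principal_curvatures \<gamma> \<nu> ! 0 \<le> - 1 / \<rho>"
    using ks(1) by (metis in_set_conv_nth le0 sorted_nth_mono)
  then show thesis using that \<open>\<rho> > 0\<close> min by blast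
qed

end

section \<open>Support inequality for convex integrands\<close>

locale C2_convex_integrand = C2_sphere_function +
  assumes positive: "\<nu> \<in> sphere 0 1 \<Longrightarrow> \<gamma> \<nu> > 0"
    and convex: "convex_integrand \<gamma>"
begin

lemma has_derivative_homogeneous_extension:
  assumes \<nu>: "\<nu> \<in> sphere 0 1"
  shows "(homogeneous_extension \<gamma> has_derivative (\<lambda>h. cahn_hoffman \<gamma> \<nu> \<bullet> h)) (at \<nu>)"
proof -
  have n: "norm \<nu> = 1" using \<nu> by simp
  have "((\<lambda>x. \<gamma> (x /\<^sub>R norm x)) has_derivative (\<lambda>h. sphere_gradient \<gamma> \<nu> \<bullet> h)) (at \<nu>)"
    using has_derivative_sphere_retract[OF n has_derivative_sphere_gradient(1)[OF \<nu>]]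
    by (simp add: inner_diff_right has_derivative_sphere_gradient(2)[OF \<nu>])
  with has_derivative_norm_sphere[OF n] have "((\<lambda>x. norm x * \<gamma> (x /\<^sub>R norm x)) has_derivative
      (\<lambda>h. norm \<nu> * (sphere_gradient \<gamma> \<nu> \<bullet> h) + (h \<bullet> \<nu>) * \<gamma> (\<nu> /\<^sub>R norm \<nu>))) (at \<nu>)"
    by (rule has_derivative_mult)
  then show ?thesis
    unfolding homogeneous_extension_def
    by (rule has_derivative_eq_rhs) (auto simp: n cahn_hoffman_def inner_add_left mult.commute inner_commute[of \<nu>])
qed

lemma homogeneous_extension_sphere: "\<nu> \<in> sphere 0 1 \<Longrightarrow> homogeneous_extension \<gamma> \<nu> = \<gamma> \<nu>"
  by (simp add: homogeneous_extension_def)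

text \<open>
  The Cahn-Hoffman vector is the gradient of the homogeneous extension, hence a subgradient of this
  convex function; by homogeneity the subgradient inequality says that the vector belongs to the
  convex body cut out by \<open>\<gamma>\<close>.
\<close>

lemma cahn_hoffman_support:
  assumes \<nu>: "\<nu> \<in> sphere 0 1" and \<mu>: "\<mu> \<in> sphere 0 1"
  shows "cahn_hoffman \<gamma> \<nu> \<bullet> \<mu> \<le> \<gamma> \<mu>"
proof -
  let ?H = "homogeneous_extension \<gamma>"
  have "((\<lambda>t. (?H (\<nu> + t *\<^sub>R (\<mu> - \<nu>)) - ?H \<nu>) /\<^sub>R t) \<longlongrightarrow> cahn_hoffman \<gamma> \<nu> \<bullet> (\<mu> - \<nu>)) (at 0)"
    by (rule has_derivative_imp_directional[OF has_derivative_homogeneous_extension[OF \<nu>]])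
  then have "((\<lambda>t. (?H (\<nu> + t *\<^sub>R (\<mu> - \<nu>)) - ?H \<nu>) /\<^sub>R t) \<longlongrightarrow> cahn_hoffman \<gamma> \<nu> \<bullet> (\<mu> - \<nu>)) (at_right 0)"
    by (rule filterlim_mono) (auto simp: at_le)
  moreover have "(?H (\<nu> + t *\<^sub>R (\<mu> - \<nu>)) - ?H \<nu>) /\<^sub>R t \<le> ?H \<mu> - ?H \<nu>" if t: "0 < t" "t < 1" for t
  proof -
    have "\<nu> + t *\<^sub>R (\<mu> - \<nu>) = (1 - t) *\<^sub>R \<nu> + t *\<^sub>R \<mu>" by (simp add: algebra_simps)
    then have "?H (\<nu> + t *\<^sub>R (\<mu> - \<nu>)) \<le> (1 - t) * ?H \<nu> + t * ?H \<mu>"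
      using convex_onD[OF convex[unfolded convex_integrand_def], of t \<nu> \<mu>] t by simp
    then have "?H (\<nu> + t *\<^sub>R (\<mu> - \<nu>)) - ?H \<nu> \<le> t * (?H \<mu> - ?H \<nu>)" by (simp add: algebra_simps)
    then show ?thesis using t by (simp add: field_simps)
  qed
  then have "\<forall>\<^sub>F t in at_right 0. (?H (\<nu> + t *\<^sub>R (\<mu> - \<nu>)) - ?H \<nu>) /\<^sub>R t \<le> ?H \<mu> - ?H \<nu>"
    by (auto simp: eventually_at_right[of 0 1] intro!: exI[of _ 1])
  ultimately have "cahn_hoffman \<gamma> \<nu> \<bullet> (\<mu> - \<nu>) \<le> ?H \<mu> - ?H \<nu>"
    by (rule tendsto_upperbound) simp
  then show ?thesis
    using inner_cahn_hoffman_self[OF \<nu>] \<nu> \<mu> by (simp add: homogeneous_extension_sphere inner_diff_right)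
qed

text \<open>The support inequality at two points makes the Cahn-Hoffman map monotone.\<close>

lemma differential_psd:
  assumes \<nu>: "\<nu> \<in> sphere 0 1" and v: "v \<in> sphere_tangent_space \<nu>"
  shows "differential \<nu> v \<bullet> v \<ge> 0"
proof -
  have "(cahn_hoffman \<gamma> u - cahn_hoffman \<gamma> \<nu>) \<bullet> (u - \<nu>) \<ge> 0 * ((u - \<nu>) \<bullet> (u - \<nu>))"
    if "u \<in> sphere 0 1" for u
    using cahn_hoffman_support[OF \<nu> that] cahn_hoffman_support[OF that \<nu>]
      inner_cahn_hoffman_self[OF \<nu>] inner_cahn_hoffman_self[OF that]
    by (simp add: inner_diff_left inner_diff_right)
  from sphere_derivative_strongly_monotone[OF _ has_derivative_cahn_hoffman[OF \<nu>] this v] \<nu>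
  show ?thesis by simp
qed

lemma cahn_hoffman_in_wulff_shape:
  assumes \<nu>: "\<nu> \<in> sphere 0 1"
  shows "cahn_hoffman \<gamma> \<nu> \<in> wulff_shape \<gamma>"
proof -
  let ?p = "cahn_hoffman \<gamma> \<nu>"
  let ?K = "\<Inter>\<nu>\<in>sphere 0 1. {Y. Y \<bullet> \<nu> \<le> \<gamma> \<nu>}"
  have nn: "norm \<nu> = 1" "\<nu> \<bullet> \<nu> = 1" using \<nu> by (auto simp: dot_square_norm)
  have "?p \<in> ?K" using cahn_hoffman_support[OF \<nu>] by auto
  then have "?p \<in> closure ?K" using closure_subset by blast
  moreover have "?p \<notin> interior ?K"
  proof
    assume "?p \<in> interior ?K"
    then obtain e where e: "e > 0" "ball ?p e \<subseteq> ?K" by (auto simp: mem_interior)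
    have "?p + (e/2) *\<^sub>R \<nu> \<in> ball ?p e" using e nn by (simp add: dist_norm)
    then have "(?p + (e/2) *\<^sub>R \<nu>) \<bullet> \<nu> \<le> \<gamma> \<nu>" using e(2) \<nu> by blast
    then show False using inner_cahn_hoffman_self[OF \<nu>] nn e(1) by (simp add: inner_add_left)
  qed
  ultimately show ?thesis by (simp add: wulff_shape_def frontier_def)
qed

section \<open>Touching balls and the density of regular points\<close>

text \<open>
  The function \<open>\<mu> \<mapsto> q \<bullet> \<mu> + r\<close> is the support function of the ball of radius \<open>r\<close> about \<open>q\<close>. If the
  homogeneous extension of \<open>\<gamma>\<close> touches that of the support function from above at \<open>\<nu>\<close>, their
  gradients at \<open>\<nu>\<close> agree. With \<open>r = 0\<close> the lemma identifies the parameters of a point \<open>q\<close> of the body.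
\<close>

lemma cahn_hoffman_eq_touching:
  assumes \<nu>: "\<nu> \<in> sphere 0 1" and below: "\<And>\<mu>. \<mu> \<in> sphere 0 1 \<Longrightarrow> q \<bullet> \<mu> + r \<le> \<gamma> \<mu>"
    and touch: "\<gamma> \<nu> = q \<bullet> \<nu> + r"
  shows "cahn_hoffman \<gamma> \<nu> = q + r *\<^sub>R \<nu>"
proof -
  have n: "norm \<nu> = 1" using \<nu> by simp
  define f where "f Y = homogeneous_extension \<gamma> Y - q \<bullet> Y - r * norm Y" for Y
  have der: "(f has_derivative (\<lambda>h. cahn_hoffman \<gamma> \<nu> \<bullet> h - q \<bullet> h - r * (h \<bullet> \<nu>))) (at \<nu>)"
    unfolding f_def
    by (intro has_derivative_diff has_derivative_homogeneous_extension[OF \<nu>] has_derivative_norm_sphere[OF n]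
        has_derivative_mult_right bounded_linear.has_derivative[OF bounded_linear_inner_right] has_derivative_ident)
  have nonneg: "f Y \<ge> 0" for Y
  proof (cases "Y = 0")
    case True then show ?thesis by (simp add: f_def homogeneous_extension_def)
  next
    case False
    define \<mu> where "\<mu> = Y /\<^sub>R norm Y"
    have \<mu>: "\<mu> \<in> sphere 0 1" using False by (simp add: \<mu>_def)
    have Y: "Y = norm Y *\<^sub>R \<mu>" using False by (simp add: \<mu>_def)
    have "q \<bullet> Y = norm Y * (q \<bullet> \<mu>)" by (metis Y inner_scaleR_right)
    then have "f Y = norm Y * (\<gamma> \<mu> - (q \<bullet> \<mu> + r))"
      by (simp add: f_def homogeneous_extension_def \<mu>_def algebra_simps)
    then show ?thesis using below[OF \<mu>] by simp
  qed
  have "f \<nu> = 0" using touch n by (simp add: f_def homogeneous_extension_sphere[OF \<nu>])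
  then have "(\<lambda>h. cahn_hoffman \<gamma> \<nu> \<bullet> h - q \<bullet> h - r * (h \<bullet> \<nu>)) = (\<lambda>h. 0)"
    using differential_zero_maxmin[OF UNIV_I open_UNIV der] nonneg by auto
  then have "(cahn_hoffman \<gamma> \<nu> - (q + r *\<^sub>R \<nu>)) \<bullet> h = 0" for h
    by (simp add: inner_diff_left inner_add_left fun_eq_iff inner_commute[of \<nu> h] diff_diff_eq)
  then show ?thesis by (metis eq_iff_diff_eq_0 inner_eq_zero_iff)
qed

text \<open>
  At a point touched from inside by a ball of radius \<open>r\<close>, the radii of curvature are bounded below
  in terms of \<open>r\<close>. The support inequalities alone give a strong monotonicity with constant \<open>r/2\<close>,
  which passes to the differential and makes it injective.
\<close>

lemma touching_ball_imp_immersion: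
  assumes \<nu>: "\<nu> \<in> sphere 0 1" and below: "\<And>\<mu>. \<mu> \<in> sphere 0 1 \<Longrightarrow> q \<bullet> \<mu> + r \<le> \<gamma> \<mu>"
    and touch: "\<gamma> \<nu> = q \<bullet> \<nu> + r" and r: "r > 0"
  shows "sphere_immersion_at (cahn_hoffman \<gamma>) \<nu>"
  unfolding immersion_iff[OF \<nu>]
proof (intro ballI impI)
  fix v assume v: "v \<in> sphere_tangent_space \<nu>" and zero: "differential \<nu> v = 0"
  have "(cahn_hoffman \<gamma> u - cahn_hoffman \<gamma> \<nu>) \<bullet> (u - \<nu>) \<ge> (r/2) * ((u - \<nu>) \<bullet> (u - \<nu>))"
    if u: "u \<in> sphere 0 1" for u
  proof -
    have \<xi>\<nu>: "cahn_hoffman \<gamma> \<nu> = q + r *\<^sub>R \<nu>"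
      by (rule cahn_hoffman_eq_touching[OF \<nu> below touch])
    have uu: "u \<bullet> u = 1" "\<nu> \<bullet> \<nu> = 1" using u \<nu> by (auto simp: dot_square_norm)
    have "cahn_hoffman \<gamma> u \<bullet> (u - \<nu>) \<ge> q \<bullet> (u - \<nu>)"
      using below[OF u] touch cahn_hoffman_support[OF u \<nu>] inner_cahn_hoffman_self[OF u]
      by (simp add: inner_diff_right)
    moreover have "cahn_hoffman \<gamma> \<nu> \<bullet> (u - \<nu>) = q \<bullet> (u - \<nu>) + r * (\<nu> \<bullet> u - 1)"
      unfolding \<xi>\<nu> by (simp add: inner_add_left inner_diff_right uu right_diff_distrib)
    moreover have "(u - \<nu>) \<bullet> (u - \<nu>) = 2 * (1 - \<nu> \<bullet> u)"
      using uu inner_commute[of u \<nu>] by (simp only: inner_diff_left inner_diff_right) simp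
    ultimately show ?thesis by (simp add: inner_diff_left right_diff_distrib)
  qed
  from sphere_derivative_strongly_monotone[OF _ has_derivative_cahn_hoffman[OF \<nu>] this v] \<nu> zero
  have "r * (v \<bullet> v) \<le> 0" by simp
  then have "v \<bullet> v \<le> 0" using r by (simp add: mult_le_0_iff)
  then show "v = 0" using inner_gt_zero_iff[of v] by linarith
qed

text \<open>
  The touching point is where the largest ball about \<open>q = (1 - t) *\<^sub>R p\<close> inside the body meets the
  Wulff shape. As \<open>\<gamma>\<close> is positive, \<open>q\<close> is an interior point and the radius is positive; as \<open>p\<close>
  itself is not interior, the radius is at most \<open>t * norm p\<close>, which keeps the touching point near
  \<open>p\<close>.
\<close>

lemma immersion_points_dense:
  assumes \<nu>: "\<nu> \<in> sphere 0 1" and e: "e > 0"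
  obtains \<mu> where "\<mu> \<in> sphere 0 1" "sphere_immersion_at (cahn_hoffman \<gamma>) \<mu>"
    "dist (cahn_hoffman \<gamma> \<mu>) (cahn_hoffman \<gamma> \<nu>) < e"
proof -
  define p where "p = cahn_hoffman \<gamma> \<nu>"
  define t where "t = min 1 (e / (2 * (norm p + 1)))"
  have np: "norm p + 1 > 0" by (simp add: add_nonneg_pos)
  then have t: "0 < t" "t \<le> 1" using e by (auto simp: t_def)
  have "t \<le> e / (2 * (norm p + 1))" by (simp add: t_def)
  then have "2 * t * (norm p + 1) \<le> e" using np by (simp add: pos_le_divide_eq algebra_simps)
  then have te: "2 * (t * norm p) < e" using t by (simp add: algebra_simps)
  define q where "q = (1 - t) *\<^sub>R p"
  have cont: "continuous_on (sphere 0 1) (\<lambda>\<mu>. \<gamma> \<mu> - q \<bullet> \<mu>)"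
  proof (intro continuous_intros)
    show "continuous_on (sphere 0 1) \<gamma>"
      using has_derivative_sphere_gradient(1) has_derivative_continuous continuous_on_eq_continuous_within by blast
  qed
  obtain \<mu> where \<mu>: "\<mu> \<in> sphere 0 1"
    and min: "\<And>\<sigma>. \<sigma> \<in> sphere 0 1 \<Longrightarrow> \<gamma> \<mu> - q \<bullet> \<mu> \<le> \<gamma> \<sigma> - q \<bullet> \<sigma>"
    using continuous_attains_inf[OF compact_sphere _ cont] \<nu> by blast
  define r where "r = \<gamma> \<mu> - q \<bullet> \<mu>"
  have below: "q \<bullet> \<sigma> + r \<le> \<gamma> \<sigma>" if "\<sigma> \<in> sphere 0 1" for \<sigma> using min[OF that] by (simp add: r_def)
  have touch: "\<gamma> \<mu> = q \<bullet> \<mu> + r" by (simp add: r_def)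
  have "(1 - t) * (p \<bullet> \<mu>) \<le> (1 - t) * \<gamma> \<mu>"
    using cahn_hoffman_support[OF \<nu> \<mu>] t by (intro mult_left_mono) (auto simp: p_def)
  also have "\<dots> < \<gamma> \<mu>" using t positive[OF \<mu>] by (simp add: algebra_simps)
  finally have r: "r > 0" by (simp add: r_def q_def)
  have "r \<le> \<gamma> \<nu> - q \<bullet> \<nu>" using below[OF \<nu>] by simp
  also have "\<dots> = t * (p \<bullet> \<nu>)"
    using inner_cahn_hoffman_self[OF \<nu>] by (simp add: p_def q_def algebra_simps)
  also have "\<dots> \<le> t * norm p"
    using norm_cauchy_schwarz[of p \<nu>] \<nu> t by simp
  finally have "r \<le> t * norm p" .
  have "cahn_hoffman \<gamma> \<mu> - p = r *\<^sub>R \<mu> - t *\<^sub>R p"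
    using cahn_hoffman_eq_touching[OF \<mu> below touch] by (simp add: q_def algebra_simps)
  then have "dist (cahn_hoffman \<gamma> \<mu>) p \<le> r + t * norm p"
    using norm_triangle_ineq4[of "r *\<^sub>R \<mu>" "t *\<^sub>R p"] \<mu> r t by (simp add: dist_norm)
  with \<open>r \<le> t * norm p\<close> te have "dist (cahn_hoffman \<gamma> \<mu>) p < e" by simp
  then show thesis
    using that[OF \<mu> touching_ball_imp_immersion[OF \<mu> below touch r]] by (simp add: p_def)
qed

section \<open>Fibres of the Cahn-Hoffman map\<close>

text \<open>
  A unit vector \<open>\<sigma>\<close> is a parameter of \<open>p\<close> exactly when \<open>p \<bullet> \<sigma> = \<gamma> \<sigma>\<close>, and the vectors \<open>x\<close> at which
  the homogeneous extension is at most \<open>p \<bullet> x\<close> form a convex cone. So the segment from \<open>\<nu>\<close> to \<open>\<mu>\<close>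
  projects into the fibre, provided that it avoids the origin; it does, since \<open>p \<bullet> x\<close> is an
  interpolation between \<open>\<gamma> \<nu>\<close> and \<open>\<gamma> \<mu>\<close> and hence positive on it.
\<close>

lemma fibre_connected:
  assumes \<nu>: "\<nu> \<in> sphere 0 1" "cahn_hoffman \<gamma> \<nu> = p" and \<mu>: "\<mu> \<in> sphere 0 1" "cahn_hoffman \<gamma> \<mu> = p"
  obtains T where "connected T" "\<nu> \<in> T" "\<mu> \<in> T"
    "\<And>\<sigma>. \<sigma> \<in> T \<Longrightarrow> \<sigma> \<in> sphere 0 1 \<and> cahn_hoffman \<gamma> \<sigma> = p"
proof -
  let ?H = "homogeneous_extension \<gamma>"
  have p\<nu>: "p \<bullet> \<nu> = \<gamma> \<nu>" and p\<mu>: "p \<bullet> \<mu> = \<gamma> \<mu>"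
    using inner_cahn_hoffman_self[OF \<nu>(1)] inner_cahn_hoffman_self[OF \<mu>(1)] \<nu>(2) \<mu>(2) by simp_all
  define T where "T = (\<lambda>x. x /\<^sub>R norm x) ` closed_segment \<nu> \<mu>"
  have pos: "p \<bullet> x > 0 \<and> ?H x \<le> p \<bullet> x" if "x \<in> closed_segment \<nu> \<mu>" for x
  proof -
    from that[unfolded in_segment] obtain t
      where "0 \<le> t \<and> t \<le> 1 \<and> x = (1 - t) *\<^sub>R \<nu> + t *\<^sub>R \<mu>" ..
    then have t: "0 \<le> t" "t \<le> 1" and x: "x = (1 - t) *\<^sub>R \<nu> + t *\<^sub>R \<mu>" by simp_all
    have px: "p \<bullet> x = (1 - t) * \<gamma> \<nu> + t * \<gamma> \<mu>" by (simp add: x inner_add_right p\<nu> p\<mu>)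
    have "?H x \<le> (1 - t) * ?H \<nu> + t * ?H \<mu>"
      using convex_onD[OF convex[unfolded convex_integrand_def], of t \<nu> \<mu>] t x by simp
    then have "?H x \<le> p \<bullet> x" using px \<nu> \<mu> by (simp add: homogeneous_extension_sphere)
    moreover have "p \<bullet> x > 0"
    proof (cases "t = 0")
      case True then show ?thesis using px positive[OF \<nu>(1)] by simp
    next
      case False
      then show ?thesis using px t positive[OF \<nu>(1)] positive[OF \<mu>(1)]
        by (simp add: add_nonneg_pos)
    qed
    ultimately show ?thesis by simp
  qed
  have nz: "x \<noteq> 0" if "x \<in> closed_segment \<nu> \<mu>" for x using pos[OF that] by auto
  have "connected T" unfolding T_def
    by (intro connected_continuous_image continuous_intros connected_segment) (use nz in auto)
  moreover have "\<nu> \<in> T" "\<mu> \<in> T"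
    unfolding T_def using \<nu>(1) \<mu>(1) by (auto intro: image_eqI[of _ _ \<nu>] image_eqI[of _ _ \<mu>])
  moreover have "\<sigma> \<in> sphere 0 1 \<and> cahn_hoffman \<gamma> \<sigma> = p" if "\<sigma> \<in> T" for \<sigma>
  proof -
    obtain x where x: "x \<in> closed_segment \<nu> \<mu>" and \<sigma>: "\<sigma> = x /\<^sub>R norm x"
      using \<open>\<sigma> \<in> T\<close> unfolding T_def by (rule imageE)
    have S: "\<sigma> \<in> sphere 0 1" using nz[OF x] by (simp add: \<sigma>)
    have sup: "p \<bullet> \<tau> + 0 \<le> \<gamma> \<tau>" if "\<tau> \<in> sphere 0 1" for \<tau>
      using cahn_hoffman_support[OF \<nu>(1) that] \<nu>(2) by simp
    have "p \<bullet> x = norm x * (p \<bullet> \<sigma>)" using nz[OF x] by (simp add: \<sigma>)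
    moreover have "norm x * \<gamma> \<sigma> \<le> p \<bullet> x"
      using pos[OF x] by (simp add: homogeneous_extension_def \<sigma>)
    ultimately have "norm x * \<gamma> \<sigma> \<le> norm x * (p \<bullet> \<sigma>)" by simp
    then have "\<gamma> \<sigma> = p \<bullet> \<sigma> + 0" using nz[OF x] sup[OF S] by simp
    from cahn_hoffman_eq_touching[OF S sup this] S show ?thesis by simp
  qed
  ultimately show thesis using that by blast
qed

section \<open>Separation of singular and uniformly regular parameters\<close>

text \<open>
  The pairs of a parameter and a unit tangent vector killed by the differential form a compact set,
  and the singular parameters are its projection.
\<close>

lemma closed_singular_parameters:
  "closed {\<nu> \<in> sphere 0 1. \<not> sphere_immersion_at (cahn_hoffman \<gamma>) \<nu>}" (is "closed ?S")
proof -
  define C where "C = {z \<in> sphere 0 1 \<times> sphere 0 1. norm (differential (fst z) (snd z)) + \<bar>snd z \<bullet> fst z\<bar> \<le> 0}"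
  have "continuous_on (sphere 0 1 \<times> sphere 0 1) (\<lambda>z. differential (fst z))"
    by (rule continuous_on_compose2[OF continuous_on_differential]) (auto intro!: continuous_intros)
  then have "closed C" unfolding C_def
    by (intro continuous_on_closed_Collect_le continuous_intros closed_Times closed_sphere)
  moreover have "C = (sphere 0 1 \<times> sphere 0 1) \<inter> C" by (auto simp: C_def)
  ultimately have "compact C"
    by (metis compact_Int_closed compact_Times compact_sphere)
  then have "closed (fst ` C)"
    by (intro compact_imp_closed compact_continuous_image continuous_intros)
  moreover have "fst ` C = ?S"
  proof (intro set_eqI iffI)
    fix \<nu> assume "\<nu> \<in> fst ` C"
    then obtain v where "\<nu> \<in> sphere 0 1" "norm v = 1" "norm (differential \<nu> v) + \<bar>v \<bullet> \<nu>\<bar> \<le> 0"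
      by (auto simp: C_def)
    moreover from this(3) have "norm (differential \<nu> v) = 0" "v \<bullet> \<nu> = 0"
      using norm_ge_zero[of "differential \<nu> v"] by linarith+
    ultimately show "\<nu> \<in> ?S"
      by (auto simp: immersion_iff sphere_tangent_space_def intro!: bexI[of _ v])
  next
    fix \<nu> assume "\<nu> \<in> ?S"
    then obtain v where \<nu>: "\<nu> \<in> sphere 0 1" and v: "v \<bullet> \<nu> = 0" "differential \<nu> v = 0" "v \<noteq> 0"
      by (auto simp: immersion_iff sphere_tangent_space_def)
    then have "(\<nu>, v /\<^sub>R norm v) \<in> C" by (simp add: C_def blinfun.scaleR_right)
    then show "\<nu> \<in> fst ` C" by force
  qed
  ultimately show ?thesis by simp
qed

text \<open>For \<open>M > 0\<close>, the parameters at which all radii of curvature are at least \<open>1/M\<close>.\<close>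

definition uniformly_regular_parameters :: "real \<Rightarrow> 'a set" where
  "uniformly_regular_parameters M = {\<nu> \<in> sphere 0 1.
     \<forall>w\<in>sphere_tangent_space \<nu>. w \<bullet> w \<le> M * (differential \<nu> w \<bullet> w)}"

text \<open>
  Tangent vectors vary with \<open>\<nu>\<close>; testing on the tangential parts of fixed ambient vectors exhibits
  the set as an intersection of closed conditions on \<open>\<nu>\<close>.
\<close>

lemma closed_uniformly_regular_parameters: "closed (uniformly_regular_parameters M)"
proof -
  define P where "P \<nu> w = w - (w \<bullet> \<nu>) *\<^sub>R \<nu>" for \<nu> w :: 'a
  have "uniformly_regular_parameters M =
    (\<Inter>w. {\<nu> \<in> sphere 0 1. P \<nu> w \<bullet> P \<nu> w \<le> M * (differential \<nu> (P \<nu> w) \<bullet> P \<nu> w)})"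
  proof (intro set_eqI iffI)
    fix \<nu> assume \<nu>: "\<nu> \<in> uniformly_regular_parameters M"
    then have "P \<nu> w \<in> sphere_tangent_space \<nu>" for w
      by (simp add: uniformly_regular_parameters_def P_def sphere_tangent_space_def inner_diff_left dot_square_norm)
    then show "\<nu> \<in> (\<Inter>w. {\<nu> \<in> sphere 0 1. P \<nu> w \<bullet> P \<nu> w \<le> M * (differential \<nu> (P \<nu> w) \<bullet> P \<nu> w)})"
      using \<nu> by (auto simp: uniformly_regular_parameters_def)
  next
    fix \<nu> assume \<nu>: "\<nu> \<in> (\<Inter>w. {\<nu> \<in> sphere 0 1. P \<nu> w \<bullet> P \<nu> w \<le> M * (differential \<nu> (P \<nu> w) \<bullet> P \<nu> w)})"
    have "P \<nu> w = w" if "w \<in> sphere_tangent_space \<nu>" for w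
      using that by (simp add: P_def sphere_tangent_space_def)
    then show "\<nu> \<in> uniformly_regular_parameters M"
      using \<nu> by (auto simp: uniformly_regular_parameters_def) metis
  qed
  also have "closed \<dots>"
    unfolding P_def
    by (intro closed_INT ballI continuous_on_closed_Collect_le continuous_intros
        continuous_on_differential closed_sphere)
  finally show ?thesis .
qed

lemma first_principal_curvature_unbounded:
  assumes p: "p \<in> wulff_singular_points \<gamma>"
    and U: "openin (top_of_set (wulff_shape \<gamma>)) U" "p \<in> U"
  shows "\<not> bounded ((\<lambda>\<nu>. principal_curvatures \<gamma> \<nu> ! 0) `
               {\<nu> \<in> wulff_regular_parameters \<gamma>. cahn_hoffman \<gamma> \<nu> \<in> U})"
proof
  assume "bounded ((\<lambda>\<nu>. principal_curvatures \<gamma> \<nu> ! 0) `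
               {\<nu> \<in> wulff_regular_parameters \<gamma>. cahn_hoffman \<gamma> \<nu> \<in> U})"
  then obtain M where M: "M > 0" "\<And>\<nu>. \<nu> \<in> sphere 0 1 \<Longrightarrow> sphere_immersion_at (cahn_hoffman \<gamma>) \<nu> \<Longrightarrow>
      cahn_hoffman \<gamma> \<nu> \<in> U \<Longrightarrow> \<bar>principal_curvatures \<gamma> \<nu> ! 0\<bar> \<le> M"
    by (auto simp: bounded_pos wulff_regular_parameters_def)
  let ?S = "{\<nu> \<in> sphere 0 1. \<not> sphere_immersion_at (cahn_hoffman \<gamma>) \<nu>}"
  let ?R = "uniformly_regular_parameters M"
  have disjoint: "?R \<inter> ?S = {}"
  proof (rule equals0I)
    fix \<nu> assume \<nu>: "\<nu> \<in> ?R \<inter> ?S"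
    then obtain v where v: "v \<in> sphere_tangent_space \<nu>" "differential \<nu> v = 0" "v \<noteq> 0"
      using immersion_iff[of \<nu>] by auto
    then have "v \<bullet> v \<le> M * (differential \<nu> v \<bullet> v)"
      using \<nu> by (auto simp: uniformly_regular_parameters_def)
    then have "v \<bullet> v \<le> 0" using v(2) by simp
    then show False using v(3) inner_gt_zero_iff[of v] by linarith
  qed
  have regular: "\<nu> \<in> ?R" if \<nu>: "\<nu> \<in> sphere 0 1" "sphere_immersion_at (cahn_hoffman \<gamma>) \<nu>"
    "cahn_hoffman \<gamma> \<nu> \<in> U" for \<nu>
  proof (cases "sphere_tangent_space \<nu> \<subseteq> {0}")
    case True
    then show ?thesis using \<nu>(1) by (auto simp: uniformly_regular_parameters_def)
  next
    case False
    obtain \<rho> where \<rho>: "\<rho> > 0" "principal_curvatures \<gamma> \<nu> ! 0 \<le> - 1 / \<rho>"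
      "\<And>w. w \<in> sphere_tangent_space \<nu> \<Longrightarrow> differential \<nu> w \<bullet> w \<ge> \<rho> * (w \<bullet> w)"
      using first_principal_curvature_bound[OF \<nu>(1,2) differential_psd[OF \<nu>(1)] False] by metis
    have "1 / \<rho> \<le> M" using M(2)[OF \<nu>] \<rho>(2) by linarith
    then have "1 \<le> M * \<rho>" using \<rho>(1) by (simp add: field_simps)
    have "w \<bullet> w \<le> M * (differential \<nu> w \<bullet> w)" if w: "w \<in> sphere_tangent_space \<nu>" for w
    proof -
      have "1 * (w \<bullet> w) \<le> (M * \<rho>) * (w \<bullet> w)" using \<open>1 \<le> M * \<rho>\<close> by (rule mult_right_mono) simp
      also have "\<dots> \<le> M * (differential \<nu> w \<bullet> w)" using \<rho>(3)[OF w] M(1) by simp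
      finally show ?thesis by simp
    qed
    then show ?thesis using \<nu>(1) by (simp add: uniformly_regular_parameters_def)
  qed
  obtain \<nu> where \<nu>: "\<nu> \<in> ?S" and p\<nu>: "cahn_hoffman \<gamma> \<nu> = p"
    using p by (auto simp: wulff_singular_points_def)
  obtain e where e: "e > 0" "ball p e \<inter> wulff_shape \<gamma> \<subseteq> U"
    using U by (metis openin_contains_ball)
  \<comment> \<open>Regular points accumulate at \<open>p\<close>, so \<open>p\<close> is also the image of a uniformly regular parameter.\<close>
  have "p \<in> closure (cahn_hoffman \<gamma> ` ?R)"
    unfolding closure_approachable
  proof (intro allI impI)
    fix d :: real assume "d > 0"
    obtain \<mu> where \<mu>: "\<mu> \<in> sphere 0 1" "sphere_immersion_at (cahn_hoffman \<gamma>) \<mu>"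
      "dist (cahn_hoffman \<gamma> \<mu>) p < min d e"
      using immersion_points_dense[of \<nu> "min d e"] \<nu> p\<nu> \<open>d > 0\<close> e(1) by auto
    then have "cahn_hoffman \<gamma> \<mu> \<in> U"
      using e(2) cahn_hoffman_in_wulff_shape[OF \<mu>(1)] by (auto simp: dist_commute)
    then show "\<exists>y\<in>cahn_hoffman \<gamma> ` ?R. dist y p < d" using regular \<mu> by auto
  qed
  moreover have "closed (cahn_hoffman \<gamma> ` ?R)"
  proof (intro compact_imp_closed compact_continuous_image)
    have sub: "?R \<subseteq> sphere 0 1" by (auto simp: uniformly_regular_parameters_def)
    show "continuous_on ?R (cahn_hoffman \<gamma>)" by (rule continuous_on_subset[OF continuous_on_cahn_hoffman sub])
    show "compact ?R"
      using compact_Int_closed[OF compact_sphere closed_uniformly_regular_parameters, of 0 1 M] sub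
      by (simp add: Int_absorb1)
  qed
  ultimately obtain \<mu> where \<mu>: "\<mu> \<in> ?R" "cahn_hoffman \<gamma> \<mu> = p" by auto
  then have "\<mu> \<in> sphere 0 1" by (simp add: uniformly_regular_parameters_def)
  then obtain T where T: "connected T" "\<nu> \<in> T" "\<mu> \<in> T"
    "\<And>\<sigma>. \<sigma> \<in> T \<Longrightarrow> \<sigma> \<in> sphere 0 1 \<and> cahn_hoffman \<gamma> \<sigma> = p"
    using fibre_connected[of \<nu> p \<mu>] \<nu> p\<nu> \<mu>(2) by blast
  have "T \<subseteq> ?R \<union> ?S" using T(4) regular U(2) by blast
  with connected_closedD[OF T(1) _ _ closed_uniformly_regular_parameters closed_singular_parameters, of M]
  show False using disjoint T(2,3) \<nu> \<mu>(1) by blast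
qed

end

text \<open>
  On the two-point sphere of a line every map is an immersion, because the tangent spaces are
  trivial. So a singular point forces \<open>n > 0\<close>, and there is a principal curvature with index \<open>0\<close>.
\<close>

lemma singular_point_imp_dim_ge_2:
  fixes \<gamma> :: "'a::euclidean_space \<Rightarrow> real"
  assumes "C2_on_sphere \<gamma>" "p \<in> wulff_singular_points \<gamma>"
  shows "DIM('a) \<ge> 2"
proof -
  interpret C2_sphere_function \<gamma> by standard (rule assms)
  obtain \<nu> where \<nu>: "\<nu> \<in> sphere 0 1" "\<not> sphere_immersion_at (cahn_hoffman \<gamma>) \<nu>"
    using assms(2) by (auto simp: wulff_singular_points_def)
  then obtain v where v: "v \<in> sphere_tangent_space \<nu>" "v \<noteq> 0"
    using immersion_iff[OF \<nu>(1)] by blast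
  have "independent {\<nu>, v}"
    using \<nu>(1) v by (intro pairwise_orthogonal_independent)
      (auto simp: pairwise_def orthogonal_def sphere_tangent_space_def inner_commute)
  then have "card {\<nu>, v} \<le> DIM('a)" using independent_bound by blast
  moreover have "\<nu> \<noteq> v" using v by (auto simp: sphere_tangent_space_def)
  ultimately show ?thesis by simp
qed

theorem corollary6p1:
  fixes \<gamma> :: "real ^ 'd \<Rightarrow> real" and n :: nat and p :: "real ^ 'd"
  assumes "CARD('d) = n + 1"
    and "\<forall>\<nu>\<in>sphere 0 1. \<gamma> \<nu> > 0"
    and "convex_integrand \<gamma>"
    and "C2_on_sphere \<gamma>"
    and "p \<in> wulff_singular_points \<gamma>"
  shows "\<exists>i<n. \<forall>U. openin (top_of_set (wulff_shape \<gamma>)) U \<and> p \<in> U \<longrightarrow>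
           \<not> bounded ((\<lambda>\<nu>. principal_curvatures \<gamma> \<nu> ! i) `
               {\<nu> \<in> wulff_regular_parameters \<gamma>. cahn_hoffman \<gamma> \<nu> \<in> U})"
proof -
  interpret C2_convex_integrand \<gamma> by standard (use assms in auto)
  have "0 < n" using singular_point_imp_dim_ge_2[OF assms(4,5)] assms(1) by simp
  then show ?thesis using first_principal_curvature_unbounded[OF assms(5)] by blast
qed

end
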